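(* Let $b$ be a positive integer relatively prime to the index of connection $f=[\check\Lambda:\check Q]$. Then the group $b\Omega$ acts freely on $\check\Lambda$, and every $b\Omega$-orbit in $\check\Lambda$ contains exactly one point of $\check Q$.
   Context: $\Phi$ is an irreducible crystallographic root system in a Euclidean space $V$ with Weyl group $W$, simple roots $\Delta$, highest root $\tilde\alpha$ (normalized $\|\tilde\alpha\|^2=2$). $\check Q$ is the coroot lattice (generated by the coroots $2\alpha/\|\alpha\|^2$) and $\check\Lambda=\{x\in V:\langle x,\alpha\rangle\in\mathbb Z\ \forall\alpha\in\Phi\}$ the coweight lattice. For $y\in V$, $t_y$ is the translation $x\mapsto x+y$. The extended affine Weyl group $\widetilde W_{\mathrm{ex}}=W\ltimes\check\Lambda$ consists of the affine maps $t_\mu w$ with $\mu\in\check\Lambda$, $w\in W$; $\mathcal A=\{x:\langle x,\alpha\rangle\ge0\ \forall\alpha\in\Delta,\ \langle x,\tilde\alpha\rangle\le1\}$ is the fundamental alcove; $\Omega=\{\widetilde w\in\widetilde W_{\mathrm{ex}}:\widetilde w\mathcal A=\mathcal A\}$ (a group of order $f$); and $b\Omega=\{t_{b\mu}w: t_\mu w\in\Omega\}$, a group of affine maps acting on $\check\Lambda$. *)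

theory Defs
  imports
    "HOL-Analysis.Analysis"
    "HOL-Algebra.Group_Action"
    "HOL-Algebra.Generated_Groups"
    "HOL-Computational_Algebra.Group_Closure"
begin

section \<open>Root systems\<close>

definition coroot :: "'a::euclidean_space \<Rightarrow> 'a" where
  "coroot \<alpha> = (2 / (\<alpha> \<bullet> \<alpha>)) *\<^sub>R \<alpha>"

definition reflection :: "'a::euclidean_space \<Rightarrow> 'a \<Rightarrow> 'a" where
  "reflection \<alpha> x = x - (x \<bullet> coroot \<alpha>) *\<^sub>R \<alpha>"

text \<open>Crystallographic root systems are reduced and span the ambient space.\<close>

definition root_system :: "'a::euclidean_space set \<Rightarrow> bool" where
  "root_system \<Phi> \<longleftrightarrow>
     finite \<Phi> \<and> 0 \<notin> \<Phi> \<and> span \<Phi> = UNIV \<and>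
     (\<forall>\<alpha>\<in>\<Phi>. \<forall>c. c *\<^sub>R \<alpha> \<in> \<Phi> \<longleftrightarrow> c = 1 \<or> c = -1) \<and>
     (\<forall>\<alpha>\<in>\<Phi>. reflection \<alpha> ` \<Phi> = \<Phi>) \<and>
     (\<forall>\<alpha>\<in>\<Phi>. \<forall>\<beta>\<in>\<Phi>. \<beta> \<bullet> coroot \<alpha> \<in> \<int>)"

definition irreducible_roots :: "'a::euclidean_space set \<Rightarrow> bool" where
  "irreducible_roots \<Phi> \<longleftrightarrow>
     \<Phi> \<noteq> {} \<and>
     \<not> (\<exists>A B. A \<noteq> {} \<and> B \<noteq> {} \<and> A \<inter> B = {} \<and> A \<union> B = \<Phi> \<and>
            (\<forall>\<alpha>\<in>A. \<forall>\<beta>\<in>B. \<alpha> \<bullet> \<beta> = 0))"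

definition simple_roots :: "'a::euclidean_space set \<Rightarrow> 'a set \<Rightarrow> bool" where
  "simple_roots \<Phi> \<Delta> \<longleftrightarrow>
     \<Delta> \<subseteq> \<Phi> \<and> independent \<Delta> \<and> span \<Delta> = UNIV \<and>
     (\<forall>\<beta>\<in>\<Phi>. \<exists>c :: 'a \<Rightarrow> int.
        \<beta> = (\<Sum>\<alpha>\<in>\<Delta>. of_int (c \<alpha>) *\<^sub>R \<alpha>) \<and>
        ((\<forall>\<alpha>\<in>\<Delta>. c \<alpha> \<ge> 0) \<or> (\<forall>\<alpha>\<in>\<Delta>. c \<alpha> \<le> 0)))"

definition highest_root :: "'a::euclidean_space set \<Rightarrow> 'a set \<Rightarrow> 'a \<Rightarrow> bool" where
  "highest_root \<Phi> \<Delta> \<theta> \<longleftrightarrow>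
     \<theta> \<in> \<Phi> \<and>
     (\<forall>\<beta>\<in>\<Phi>. \<exists>c :: 'a \<Rightarrow> nat. \<theta> - \<beta> = (\<Sum>\<alpha>\<in>\<Delta>. of_nat (c \<alpha>) *\<^sub>R \<alpha>))"

section \<open>Weyl group and lattices\<close>

definition weyl_group :: "'a::euclidean_space set \<Rightarrow> ('a \<Rightarrow> 'a) set" where
  "weyl_group \<Phi> = generate (BijGroup UNIV) (reflection ` \<Phi>)"

definition coroot_lattice :: "'a::euclidean_space set \<Rightarrow> 'a set" where
  "coroot_lattice \<Phi> = group_closure (coroot ` \<Phi>)"

definition coweight_lattice :: "'a::euclidean_space set \<Rightarrow> 'a set" where
  "coweight_lattice \<Phi> = {x. \<forall>\<alpha>\<in>\<Phi>. x \<bullet> \<alpha> \<in> \<int>}"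

definition coweight_group :: "'a::euclidean_space set \<Rightarrow> 'a monoid" where
  "coweight_group \<Phi> = \<lparr>carrier = coweight_lattice \<Phi>, mult = (+), one = 0\<rparr>"

definition index_of_connection :: "'a::euclidean_space set \<Rightarrow> nat" where
  "index_of_connection \<Phi> = card (rcosets\<^bsub>coweight_group \<Phi>\<^esub> (coroot_lattice \<Phi>))"

section \<open>The extended affine Weyl group and the stabilizer of the fundamental alcove\<close>

definition translation :: "'a::euclidean_space \<Rightarrow> 'a \<Rightarrow> 'a" where
  "translation y x = x + y"

definition extended_affine_weyl :: "'a::euclidean_space set \<Rightarrow> ('a \<Rightarrow> 'a) set" where
  "extended_affine_weyl \<Phi> =
     {translation \<mu> \<circ> w | \<mu> w. \<mu> \<in> coweight_lattice \<Phi> \<and> w \<in> weyl_group \<Phi>}"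

definition fundamental_alcove :: "'a::euclidean_space set \<Rightarrow> 'a \<Rightarrow> 'a set" where
  "fundamental_alcove \<Delta> \<theta> = {x. (\<forall>\<alpha>\<in>\<Delta>. x \<bullet> \<alpha> \<ge> 0) \<and> x \<bullet> \<theta> \<le> 1}"

definition Omega :: "'a::euclidean_space set \<Rightarrow> 'a set \<Rightarrow> 'a \<Rightarrow> ('a \<Rightarrow> 'a) set" where
  "Omega \<Phi> \<Delta> \<theta> =
     {g \<in> extended_affine_weyl \<Phi>. g ` fundamental_alcove \<Delta> \<theta> = fundamental_alcove \<Delta> \<theta>}"

definition dilated_Omega ::
    "nat \<Rightarrow> 'a::euclidean_space set \<Rightarrow> 'a set \<Rightarrow> 'a \<Rightarrow> ('a \<Rightarrow> 'a) set" where
  "dilated_Omega b \<Phi> \<Delta> \<theta> =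
     {translation (real b *\<^sub>R \<mu>) \<circ> w | \<mu> w.
        \<mu> \<in> coweight_lattice \<Phi> \<and> w \<in> weyl_group \<Phi> \<and> translation \<mu> \<circ> w \<in> Omega \<Phi> \<Delta> \<theta>}"

definition dilated_Omega_group ::
    "nat \<Rightarrow> 'a::euclidean_space set \<Rightarrow> 'a set \<Rightarrow> 'a \<Rightarrow> ('a \<Rightarrow> 'a) monoid" where
  "dilated_Omega_group b \<Phi> \<Delta> \<theta> = (BijGroup UNIV)\<lparr>carrier := dilated_Omega b \<Phi> \<Delta> \<theta>\<rparr>"

text \<open>
  Restriction of a map of the ambient space to the coweight lattice; it is extensional because
  \<^const>\<open>BijGroup\<close> consists of extensional functions.
\<close>

definition lattice_action :: "'a::euclidean_space set \<Rightarrow> ('a \<Rightarrow> 'a) \<Rightarrow> 'a \<Rightarrow> 'a" where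
  "lattice_action \<Phi> g = restrict g (coweight_lattice \<Phi>)"

definition free_action :: "('g, 'm) monoid_scheme \<Rightarrow> 'x set \<Rightarrow> ('g \<Rightarrow> 'x \<Rightarrow> 'x) \<Rightarrow> bool" where
  "free_action G E \<phi> \<longleftrightarrow> group_action G E \<phi> \<and> (\<forall>x\<in>E. stabilizer G \<phi> x = {\<one>\<^bsub>G\<^esub>})"

end

(*
  An element x -> w x + mu of the extended affine Weyl group acts on the quotient of the coweight
  lattice L by the coroot lattice Q as the translation by mu, since the Weyl group acts trivially
  there. The affine Weyl group (mu in Q) is simply transitive on alcoves: transitivity shows that
  every class of L/Q is the translation part of some element of Omega, and simplicity that only the
  identity of Omega has its translation part in Q. So Omega is identified with L/Q, and the dilated
  group acts on L/Q by the translations b mu. Multiplication by b is bijective on L/Q because b is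
  prime to the order of L/Q, so this action is simply transitive, which gives both claims.
*)

theory Submission
  imports Defs "HOL-Algebra.Multiplicative_Group"
begin

section \<open>Bijections of a type\<close>

text \<open>Alcoves never occur as a family of sets: the alcove \<open>g A\<close> is represented by
  the point \<open>g p\<close>, where \<open>p\<close> is \<rho> / h for the sum \<rho> of the
  fundamental coweights. No affine root vanishes at \<open>p\<close>, and all of them take values in
  (1/h)Z there. The first property turns \<open>g A = A\<close> into \<open>g p \<in> A\<close>; the
  second makes the orbit of \<open>p\<close> discrete and gives descents on values at
  \<open>p\<close> a natural-number measure. The obstacle is that two descriptions of the affine
  Weyl group are needed. As W extended by translations from Q it visibly preserves classes in L/Q,
  but the exchange argument for simplicity works on words in the reflections in the walls of
  \<open>A\<close>. The two are identified by conjugating every affine reflection down to a wall.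
  Freeness and uniqueness of the point of Q are one statement: an element of the dilated group that
  moves some point of L by an element of Q is the identity.\<close>

lemma carrier_BijGroup_UNIV: "f \<in> carrier (BijGroup UNIV) \<longleftrightarrow> bij f"
  by (simp add: BijGroup_def Bij_def)

lemma mult_BijGroup_UNIV: "bij f \<Longrightarrow> bij g \<Longrightarrow> f \<otimes>\<^bsub>BijGroup UNIV\<^esub> g = f \<circ> g"
  by (auto simp: BijGroup_def Bij_def compose_def fun_eq_iff)

lemma one_BijGroup_UNIV: "\<one>\<^bsub>BijGroup UNIV\<^esub> = id"
  by (auto simp: BijGroup_def fun_eq_iff)

lemma inv_BijGroup_UNIV: "bij f \<Longrightarrow> inv\<^bsub>BijGroup UNIV\<^esub> f = inv_into UNIV f"
  by (subst inv_BijGroup) (auto simp: Bij_def)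

section \<open>Affine reflections\<close>

text \<open>A pair \<open>(\<beta>, m)\<close> of a root and an integer stands for the affine function
  \<open>x \<mapsto> \<langle>x, \<beta>\<rangle> + m\<close>.\<close>

definition aff_val :: "'a::euclidean_space \<times> int \<Rightarrow> 'a \<Rightarrow> real" where
  "aff_val r x = x \<bullet> fst r + of_int (snd r)"

definition aff_reflection :: "'a::euclidean_space \<times> int \<Rightarrow> 'a \<Rightarrow> 'a" where
  "aff_reflection r x = x - aff_val r x *\<^sub>R coroot (fst r)"

definition word :: "('a::euclidean_space \<times> int) list \<Rightarrow> 'a \<Rightarrow> 'a" where
  "word rs = foldr (\<lambda>r g. aff_reflection r \<circ> g) rs id"

lemma word_Nil [simp]: "word [] = id"
  and word_Cons: "word (r # rs) = aff_reflection r \<circ> word rs"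
  by (simp_all add: word_def)

lemma word_append: "word (rs @ ss) = word rs \<circ> word ss"
  by (induction rs) (simp_all add: word_Cons comp_assoc)

lemma aff_val_uminus: "aff_val (- r) x = - aff_val r x"
  by (simp add: aff_val_def)

lemma aff_reflection_uminus: "aff_reflection (- r) = aff_reflection r"
  by (simp add: fun_eq_iff aff_reflection_def aff_val_uminus coroot_def)

lemma inner_coroot_self: "\<alpha> \<noteq> 0 \<Longrightarrow> \<alpha> \<bullet> coroot \<alpha> = 2"
  by (simp add: coroot_def)

lemma aff_val_aff_reflection_self:
  "fst r \<noteq> 0 \<Longrightarrow> aff_val r (aff_reflection r x) = - aff_val r x"
  by (simp add: aff_reflection_def aff_val_def inner_diff_left inner_commute[of "coroot _"]
      inner_coroot_self)

lemma aff_reflection_involution: "fst r \<noteq> 0 \<Longrightarrow> aff_reflection r \<circ> aff_reflection r = id"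
  using aff_val_aff_reflection_self[of r]
  by (simp add: fun_eq_iff aff_reflection_def[of r])

lemma aff_reflection_fix: "aff_val r x = 0 \<Longrightarrow> aff_reflection r x = x"
  by (simp add: aff_reflection_def)

lemma reflection_eq_aff_reflection: "reflection \<alpha> = aff_reflection (\<alpha>, 0)"
  by (simp add: fun_eq_iff reflection_def aff_reflection_def aff_val_def coroot_def)

text \<open>Places affine reflections in the extended affine Weyl group, with translation part in
  the coroot lattice.\<close>

lemma aff_reflection_eq_translation:
  "aff_reflection (\<alpha>, m) = translation (- of_int m *\<^sub>R coroot \<alpha>) \<circ> reflection \<alpha>"
  by (simp add: fun_eq_iff translation_def reflection_eq_aff_reflection aff_reflection_def
      aff_val_def scaleR_left_distrib)

text \<open>Expanding the square leaves a correction with the sign of the product of the two values.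
  Reflecting \<open>y\<close> in a hyperplane that strictly separates it from \<open>p\<close>
  therefore brings it closer to \<open>p\<close>.\<close>

lemma norm_aff_reflection_diff:
  assumes "fst r \<noteq> 0"
  shows "(norm (aff_reflection r y - p))\<^sup>2 =
    (norm (y - p))\<^sup>2 + 4 * aff_val r y * aff_val r p / (fst r \<bullet> fst r)"
proof -
  define b where "b = fst r"
  define v where "v = aff_val r y"
  have b: "b \<bullet> b \<noteq> 0" using assms by (simp add: b_def)
  have d: "(y - p) \<bullet> b = v - aff_val r p" by (simp add: v_def b_def aff_val_def inner_diff_left)
  define k where "k = v * (2 / (b \<bullet> b))"
  have k: "k * (b \<bullet> b) = 2 * v" using b by (simp add: k_def)
  have "aff_reflection r y - p = (y - p) - k *\<^sub>R b"
    by (simp add: aff_reflection_def v_def b_def coroot_def k_def)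
  then have "(norm (aff_reflection r y - p))\<^sup>2 = ((y - p) - k *\<^sub>R b) \<bullet> ((y - p) - k *\<^sub>R b)"
    by (simp only: power2_norm_eq_inner)
  also have "\<dots> = (y - p) \<bullet> (y - p) - 2 * k * ((y - p) \<bullet> b) + k * (k * (b \<bullet> b))"
    unfolding inner_diff_left[of "y - p"] inner_diff_right[of _ "y - p"] inner_scaleR_left inner_scaleR_right
      inner_commute[of b "y - p"]
    by (simp add: right_diff_distrib)
  also have "\<dots> = (y - p) \<bullet> (y - p) + 2 * k * aff_val r p"
    unfolding d k by (simp add: right_diff_distrib)
  also have "2 * k * aff_val r p = 4 * v * aff_val r p / (b \<bullet> b)"
    by (simp add: k_def)
  finally show ?thesis by (simp add: v_def b_def power2_norm_eq_inner)
qed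

text \<open>A linear functional extending \<open>f\<close> is represented by the value of its
  adjoint at 1.\<close>

lemma exists_dual_vector:
  fixes B :: "'a::euclidean_space set" and f :: "'a \<Rightarrow> real"
  assumes "independent B"
  shows "\<exists>x. \<forall>b\<in>B. x \<bullet> b = f b"
proof -
  obtain g where g: "linear g" "\<forall>b\<in>B. g b = f b"
    using linear_independent_extend[OF assms, of f] by auto
  have "adjoint g 1 \<bullet> b = f b" if "b \<in> B" for b
    using adjoint_works[OF g(1), of b 1] g(2) that by (simp add: inner_commute)
  then show ?thesis by blast
qed

section \<open>The Weyl group\<close>

locale based_root_system =
  fixes \<Phi> \<Delta> :: "'a::euclidean_space set" and \<theta> :: 'a
  assumes root_system: "root_system \<Phi>"
    and simple_roots: "simple_roots \<Phi> \<Delta>"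
    and highest_root: "highest_root \<Phi> \<Delta> \<theta>"
begin

abbreviation "W \<equiv> weyl_group \<Phi>"
abbreviation "Q \<equiv> coroot_lattice \<Phi>"
abbreviation "L \<equiv> coweight_lattice \<Phi>"
abbreviation "A \<equiv> fundamental_alcove \<Delta> \<theta>"
abbreviation "R \<equiv> \<Phi> \<times> (UNIV :: int set)"

lemma root_nonzero: "\<alpha> \<in> \<Phi> \<Longrightarrow> \<alpha> \<noteq> 0"
  using root_system by (auto simp: root_system_def)

lemma aff_root_nonzero: "r \<in> R \<Longrightarrow> fst r \<noteq> 0"
  using root_nonzero by auto

lemma root_scaleR: "\<alpha> \<in> \<Phi> \<Longrightarrow> c *\<^sub>R \<alpha> \<in> \<Phi> \<longleftrightarrow> c = 1 \<or> c = -1"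
  using root_system unfolding root_system_def by blast

lemma root_uminus: "\<alpha> \<in> \<Phi> \<Longrightarrow> - \<alpha> \<in> \<Phi>"
  using root_scaleR[of \<alpha> "-1"] by simp

lemma reflection_root: "\<alpha> \<in> \<Phi> \<Longrightarrow> \<beta> \<in> \<Phi> \<Longrightarrow> reflection \<alpha> \<beta> \<in> \<Phi>"
  using root_system unfolding root_system_def by blast

lemma cartan_int: "\<alpha> \<in> \<Phi> \<Longrightarrow> \<beta> \<in> \<Phi> \<Longrightarrow> \<beta> \<bullet> coroot \<alpha> \<in> \<int>"
  using root_system unfolding root_system_def by blast

lemma reflection_involution: "\<alpha> \<in> \<Phi> \<Longrightarrow> reflection \<alpha> \<circ> reflection \<alpha> = id"
  by (simp add: reflection_eq_aff_reflection aff_reflection_involution root_nonzero)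

lemma bij_reflection: "\<alpha> \<in> \<Phi> \<Longrightarrow> bij (reflection \<alpha>)"
  using reflection_involution o_bij by blast

lemma inv_reflection: "\<alpha> \<in> \<Phi> \<Longrightarrow> inv_into UNIV (reflection \<alpha>) = reflection \<alpha>"
  using reflection_involution by (metis inv_unique_comp)

lemma linear_reflection: "linear (reflection \<alpha>)"
  by (rule linearI) (simp_all add: reflection_def inner_add_left algebra_simps)

lemma inner_reflection:
  assumes "\<alpha> \<in> \<Phi>" shows "reflection \<alpha> x \<bullet> reflection \<alpha> y = x \<bullet> y"
proof -
  have "\<alpha> \<bullet> \<alpha> \<noteq> 0" using root_nonzero[OF assms] by simp
  then show ?thesis
    by (simp add: reflection_def coroot_def inner_diff_left inner_diff_right inner_commute)
qed

lemma weyl_subgroup: "subgroup W (BijGroup UNIV)"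
  unfolding weyl_group_def
  by (rule group.generate_is_subgroup[OF group_BijGroup])
    (auto simp: carrier_BijGroup_UNIV bij_reflection)

lemma weyl_bij: "w \<in> W \<Longrightarrow> bij w"
  using subgroup.subset[OF weyl_subgroup] carrier_BijGroup_UNIV by blast

lemma weyl_id: "id \<in> W"
  using subgroup.one_closed[OF weyl_subgroup] by (simp add: one_BijGroup_UNIV)

lemma weyl_comp: "v \<in> W \<Longrightarrow> w \<in> W \<Longrightarrow> v \<circ> w \<in> W"
  using subgroup.m_closed[OF weyl_subgroup, of v w] by (simp add: mult_BijGroup_UNIV weyl_bij)

lemma weyl_inv: "w \<in> W \<Longrightarrow> inv_into UNIV w \<in> W"
  using subgroup.m_inv_closed[OF weyl_subgroup, of w] by (simp add: inv_BijGroup_UNIV weyl_bij)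

lemma weyl_reflection: "\<alpha> \<in> \<Phi> \<Longrightarrow> reflection \<alpha> \<in> W"
  by (auto simp: weyl_group_def intro: generate.incl)

text \<open>Inverses need no case of their own, since the generators are involutions.\<close>

lemma weyl_induct [consumes 1, case_names id reflection comp]:
  assumes "w \<in> W" "P id" "\<And>\<alpha>. \<alpha> \<in> \<Phi> \<Longrightarrow> P (reflection \<alpha>)"
    "\<And>v w. v \<in> W \<Longrightarrow> w \<in> W \<Longrightarrow> P v \<Longrightarrow> P w \<Longrightarrow> P (v \<circ> w)"
  shows "P w"
  using assms(1) unfolding weyl_group_def
proof (induction rule: generate.induct)
  case one then show ?case using assms(2) by (simp only: one_BijGroup_UNIV)
next
  case (incl h) then show ?case using assms(3) by blast
next
  case (inv h) then show ?case using assms(3)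
    by (auto simp: inv_BijGroup_UNIV bij_reflection inv_reflection)
next
  case (eng h1 h2)
  then have "h1 \<in> W" "h2 \<in> W" by (auto simp: weyl_group_def)
  then show ?case using assms(4) eng by (simp only: mult_BijGroup_UNIV weyl_bij)
qed

lemma weyl_linear: "w \<in> W \<Longrightarrow> linear w"
  by (induction rule: weyl_induct)
    (simp_all only: linear_reflection linear_compose linear_id)

lemma weyl_inner: "w \<in> W \<Longrightarrow> w x \<bullet> w y = x \<bullet> y"
  by (induction arbitrary: x y rule: weyl_induct) (auto simp: inner_reflection)

lemma weyl_root: "w \<in> W \<Longrightarrow> \<alpha> \<in> \<Phi> \<Longrightarrow> w \<alpha> \<in> \<Phi>"
  by (induction arbitrary: \<alpha> rule: weyl_induct) (auto simp: reflection_root)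

lemma weyl_inv_inner: "w \<in> W \<Longrightarrow> w x \<bullet> y = x \<bullet> inv_into UNIV w y"
  using weyl_inner[of w x "inv_into UNIV w y"] weyl_bij[of w]
  by (simp add: bij_is_surj surj_f_inv_f)

lemma weyl_coroot: "w \<in> W \<Longrightarrow> w (coroot \<alpha>) = coroot (w \<alpha>)"
  by (simp add: coroot_def weyl_inner linear_cmul[OF weyl_linear])

section \<open>Lattices\<close>

lemma Q_diff: "x \<in> Q \<Longrightarrow> y \<in> Q \<Longrightarrow> x - y \<in> Q"
  by (simp add: coroot_lattice_def group_closure.diff)

lemma Q_zero: "0 \<in> Q"
  by (simp add: coroot_lattice_def)

lemma Q_uminus: "- x \<in> Q \<longleftrightarrow> x \<in> Q"
  by (simp add: coroot_lattice_def)

lemma Q_add: "x \<in> Q \<Longrightarrow> y \<in> Q \<Longrightarrow> x + y \<in> Q"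
  by (simp add: coroot_lattice_def group_closure_add)

lemma Q_coroot: "\<alpha> \<in> \<Phi> \<Longrightarrow> coroot \<alpha> \<in> Q"
  by (simp add: coroot_lattice_def group_closure.base)

lemma Q_nat_mult: "x \<in> Q \<Longrightarrow> real n *\<^sub>R x \<in> Q"
  by (induction n) (auto simp: Q_zero scaleR_left_distrib intro: Q_add)

lemma Q_int_mult: "x \<in> Q \<Longrightarrow> real_of_int n *\<^sub>R x \<in> Q"
proof (cases "n \<ge> 0")
  case True
  assume "x \<in> Q" with True show ?thesis using Q_nat_mult[of x "nat n"] by simp
next
  case False
  assume "x \<in> Q" with False show ?thesis
    using Q_nat_mult[of x "nat (- n)"] Q_uminus[of "real_of_int n *\<^sub>R x"] by simp
qed

lemma L_zero: "0 \<in> L" by (simp add: coweight_lattice_def)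

lemma L_add: "x \<in> L \<Longrightarrow> y \<in> L \<Longrightarrow> x + y \<in> L"
  by (simp add: coweight_lattice_def inner_add_left)

lemma L_uminus: "x \<in> L \<Longrightarrow> - x \<in> L"
  by (simp add: coweight_lattice_def)

lemma L_diff: "x \<in> L \<Longrightarrow> y \<in> L \<Longrightarrow> x - y \<in> L"
  by (simp add: coweight_lattice_def inner_diff_left)

lemma L_int_mult: "x \<in> L \<Longrightarrow> real_of_int n *\<^sub>R x \<in> L"
  by (simp add: coweight_lattice_def)

lemma L_nat_mult: "x \<in> L \<Longrightarrow> real n *\<^sub>R x \<in> L"
  using L_int_mult[of x "int n"] by simp

lemma Q_subset_L: "Q \<subseteq> L"
proof
  fix x assume "x \<in> Q" then show "x \<in> L"
    unfolding coroot_lattice_def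
  proof (induction rule: group_closure.induct)
    case (base s) then show ?case
      using cartan_int by (auto simp: coweight_lattice_def inner_commute)
  qed (rule L_diff)
qed

lemma weyl_L: "w \<in> W \<Longrightarrow> x \<in> L \<Longrightarrow> w x \<in> L"
  by (simp add: coweight_lattice_def weyl_inv_inner weyl_root weyl_inv)

text \<open>A reflection moves \<open>x\<close> by the integer \<open>x \<bullet> \<alpha>\<close>
  times a coroot; for a product the displacements add up, because W preserves L.\<close>

lemma weyl_Q: "w \<in> W \<Longrightarrow> x \<in> L \<Longrightarrow> w x - x \<in> Q"
proof (induction arbitrary: x rule: weyl_induct)
  case id then show ?case by (simp add: Q_zero)
next
  case (reflection \<alpha>)
  then obtain n where "x \<bullet> \<alpha> = of_int n" by (auto simp: coweight_lattice_def elim: Ints_cases)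
  then have "reflection \<alpha> x - x = - (real_of_int n *\<^sub>R coroot \<alpha>)"
    by (simp add: reflection_eq_aff_reflection aff_reflection_def aff_val_def)
  then show ?case using reflection by (simp add: Q_uminus Q_int_mult Q_coroot)
next
  case (comp v w)
  have "(v (w x) - w x) + (w x - x) \<in> Q"
    using comp weyl_L by (blast intro: Q_add)
  then show ?case by simp
qed

section \<open>The extended affine Weyl group\<close>

abbreviation "E \<equiv> extended_affine_weyl \<Phi>"

lemma E_I: "\<mu> \<in> L \<Longrightarrow> w \<in> W \<Longrightarrow> translation \<mu> \<circ> w \<in> E"
  by (auto simp: extended_affine_weyl_def)

lemma E_id: "id \<in> E"
  using E_I[OF L_zero weyl_id] by (simp add: translation_def id_def comp_def)

lemma translation_weyl_comp:
  "w \<in> W \<Longrightarrow> (translation \<mu> \<circ> w) \<circ> (translation \<nu> \<circ> v) = translation (\<mu> + w \<nu>) \<circ> (w \<circ> v)"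
  by (simp add: fun_eq_iff translation_def linear_add[OF weyl_linear] algebra_simps)

lemma E_comp: "g \<in> E \<Longrightarrow> g' \<in> E \<Longrightarrow> g \<circ> g' \<in> E"
  unfolding extended_affine_weyl_def
  by (auto simp: translation_weyl_comp) (metis weyl_comp weyl_L L_add)

lemma translation_weyl_inverse:
  assumes "w \<in> W"
  defines "v \<equiv> inv_into UNIV w"
  shows "(translation \<mu> \<circ> w) \<circ> (translation (- v \<mu>) \<circ> v) = id"
    and "(translation (- v \<mu>) \<circ> v) \<circ> (translation \<mu> \<circ> w) = id"
proof -
  have v: "v \<in> W" "\<And>x. v (w x) = x" "\<And>x. w (v x) = x"
    using weyl_inv[OF assms(1)] weyl_bij[OF assms(1)]
    by (auto simp: v_def bij_is_surj bij_is_inj surj_f_inv_f inv_f_f)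
  show "(translation \<mu> \<circ> w) \<circ> (translation (- v \<mu>) \<circ> v) = id"
    using v by (simp add: translation_weyl_comp assms(1) linear_neg[OF weyl_linear])
      (simp add: fun_eq_iff translation_def)
  show "(translation (- v \<mu>) \<circ> v) \<circ> (translation \<mu> \<circ> w) = id"
    using v by (simp add: translation_weyl_comp) (simp add: fun_eq_iff translation_def)
qed

lemma E_inverse:
  assumes "g \<in> E" obtains g' where "g' \<in> E" "g \<circ> g' = id" "g' \<circ> g = id"
proof -
  obtain \<mu> w where "\<mu> \<in> L" "w \<in> W" "g = translation \<mu> \<circ> w"
    using assms by (auto simp: extended_affine_weyl_def)
  note g = this
  have "translation (- inv_into UNIV w \<mu>) \<circ> inv_into UNIV w \<in> E"
    using g weyl_L[OF weyl_inv] by (simp add: E_I weyl_inv L_uminus)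
  then show ?thesis
    using translation_weyl_inverse[OF g(2), of \<mu>] that unfolding g(3) by blast
qed

lemma E_pullback:
  assumes "g \<in> E" "r \<in> R"
  obtains r' where "r' \<in> R" "\<And>x. aff_val r (g x) = aff_val r' x"
    "aff_reflection r \<circ> g = g \<circ> aff_reflection r'"
proof -
  obtain \<mu> w where g: "\<mu> \<in> L" "w \<in> W" "g = translation \<mu> \<circ> w"
    using assms by (auto simp: extended_affine_weyl_def)
  obtain \<beta> m where r: "r = (\<beta>, m)" "\<beta> \<in> \<Phi>" using assms by auto
  obtain n where n: "\<mu> \<bullet> \<beta> = of_int n" using g(1) r(2) by (auto simp: coweight_lattice_def elim: Ints_cases)
  define v where "v = inv_into UNIV w"
  have wv: "w (v \<beta>) = \<beta>" using weyl_bij[OF g(2)] by (simp add: v_def bij_is_surj surj_f_inv_f)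
  have val: "aff_val r (g x) = aff_val (v \<beta>, m + n) x" for x
    using g by (simp add: r aff_val_def translation_def inner_add_left weyl_inv_inner v_def n)
  show ?thesis
  proof (rule that[of "(v \<beta>, m + n)"])
    show "(v \<beta>, m + n) \<in> R" using weyl_inv[OF g(2)] r weyl_root by (auto simp: v_def)
    show "aff_reflection r \<circ> g = g \<circ> aff_reflection (v \<beta>, m + n)"
    proof
      fix x
      have "(aff_reflection r \<circ> g) x = g x - aff_val (v \<beta>, m + n) x *\<^sub>R coroot \<beta>"
        by (simp add: aff_reflection_def val) (simp add: r)
      also have "coroot \<beta> = w (coroot (v \<beta>))" by (simp add: weyl_coroot g wv)
      also have "g x - aff_val (v \<beta>, m + n) x *\<^sub>R w (coroot (v \<beta>)) = (g \<circ> aff_reflection (v \<beta>, m + n)) x"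
        by (simp add: g(3) aff_reflection_def[of "(v \<beta>, m + n)"] translation_def
            linear_diff[OF weyl_linear] linear_cmul[OF weyl_linear] g(2))
      finally show "(aff_reflection r \<circ> g) x = (g \<circ> aff_reflection (v \<beta>, m + n)) x" .
    qed
  qed (fact val)
qed

lemma aff_reflection_E:
  assumes "r \<in> R" shows "aff_reflection r \<in> E"
proof -
  obtain \<beta> m where r: "r = (\<beta>, m)" "\<beta> \<in> \<Phi>" using assms by auto
  have "- of_int m *\<^sub>R coroot \<beta> \<in> L"
    using Q_subset_L Q_int_mult[OF Q_coroot[OF r(2)], of "- m"] by auto
  then show ?thesis unfolding r aff_reflection_eq_translation
    by (intro E_I weyl_reflection r)
qed

lemma word_E: "set rs \<subseteq> R \<Longrightarrow> word rs \<in> E"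
  by (induction rs) (auto simp: E_id word_Cons intro!: E_comp aff_reflection_E)

section \<open>Positivity and the fundamental alcove\<close>

lemma simple_root: "\<alpha> \<in> \<Delta> \<Longrightarrow> \<alpha> \<in> \<Phi>"
  using simple_roots by (auto simp: simple_roots_def)

lemma simple_dual_vector: "\<exists>x. \<forall>\<alpha>\<in>\<Delta>. x \<bullet> \<alpha> = f \<alpha>" for f :: "'a \<Rightarrow> real"
  by (rule exists_dual_vector) (use simple_roots in \<open>simp add: simple_roots_def\<close>)

lemma finite_simple: "finite \<Delta>"
  using simple_roots independent_bound by (auto simp: simple_roots_def)

lemma theta_root: "\<theta> \<in> \<Phi>"
  using highest_root by (simp add: highest_root_def)

text \<open>For a root, membership is positivity; the same set also contains every difference
  \<theta> - \<beta>, so one set of estimates serves both.\<close>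

definition pos_cone :: "'a set" where
  "pos_cone = {\<Sum>\<alpha>\<in>\<Delta>. of_nat (c \<alpha>) *\<^sub>R \<alpha> | c :: 'a \<Rightarrow> nat. True}"

lemma pos_coneI: "(\<Sum>\<alpha>\<in>\<Delta>. of_nat (c \<alpha>) *\<^sub>R \<alpha>) \<in> pos_cone" for c :: "'a \<Rightarrow> nat"
  unfolding pos_cone_def by blast

lemma highest_root_cone: "\<beta> \<in> \<Phi> \<Longrightarrow> \<theta> - \<beta> \<in> pos_cone"
  using highest_root pos_coneI unfolding highest_root_def by metis

lemma root_cone_cases:
  assumes "\<beta> \<in> \<Phi>" obtains "\<beta> \<in> pos_cone" | "- \<beta> \<in> pos_cone"
proof -
  obtain c :: "'a \<Rightarrow> int" where c: "\<beta> = (\<Sum>\<alpha>\<in>\<Delta>. of_int (c \<alpha>) *\<^sub>R \<alpha>)"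
    "(\<forall>\<alpha>\<in>\<Delta>. c \<alpha> \<ge> 0) \<or> (\<forall>\<alpha>\<in>\<Delta>. c \<alpha> \<le> 0)"
    using simple_roots assms unfolding simple_roots_def by blast
  from c(2) show ?thesis
  proof
    assume "\<forall>\<alpha>\<in>\<Delta>. c \<alpha> \<ge> 0"
    then have "\<beta> = (\<Sum>\<alpha>\<in>\<Delta>. of_nat (nat (c \<alpha>)) *\<^sub>R \<alpha>)"
      unfolding c(1) by (intro sum.cong) auto
    then show ?thesis using that(1) pos_coneI[of "\<lambda>\<alpha>. nat (c \<alpha>)"] by simp
  next
    assume "\<forall>\<alpha>\<in>\<Delta>. c \<alpha> \<le> 0"
    then have "- \<beta> = (\<Sum>\<alpha>\<in>\<Delta>. of_nat (nat (- c \<alpha>)) *\<^sub>R \<alpha>)"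
      unfolding c(1) sum_negf[symmetric] by (intro sum.cong) auto
    then show ?thesis using that(2) pos_coneI[of "\<lambda>\<alpha>. nat (- c \<alpha>)"] by simp
  qed
qed

lemma cone_nonneg:
  assumes "\<beta> \<in> pos_cone" "\<And>\<alpha>. \<alpha> \<in> \<Delta> \<Longrightarrow> x \<bullet> \<alpha> \<ge> 0" shows "x \<bullet> \<beta> \<ge> 0"
  using assms by (auto simp: pos_cone_def inner_sum_right intro!: sum_nonneg)

text \<open>A vanishing sum of nonnegative terms kills every coefficient except that of \<gamma>.
  With \<gamma> = 0 this yields strict positivity in \<open>cone_pos\<close>; with \<gamma> simple
  it isolates a facet of the alcove.\<close>

lemma cone_eq_zero_multiple:
  assumes "\<beta> \<in> pos_cone" "\<And>\<alpha>. \<alpha> \<in> \<Delta> \<Longrightarrow> x \<bullet> \<alpha> \<ge> 0" "x \<bullet> \<beta> = 0"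
    "\<And>\<alpha>. \<alpha> \<in> \<Delta> \<Longrightarrow> \<alpha> \<noteq> \<gamma> \<Longrightarrow> x \<bullet> \<alpha> > 0"
  shows "\<exists>n::nat. \<beta> = of_nat n *\<^sub>R \<gamma>"
proof -
  obtain c :: "'a \<Rightarrow> nat" where c: "\<beta> = (\<Sum>\<alpha>\<in>\<Delta>. of_nat (c \<alpha>) *\<^sub>R \<alpha>)"
    using assms(1) by (auto simp: pos_cone_def)
  have "(\<Sum>\<alpha>\<in>\<Delta>. of_nat (c \<alpha>) * (x \<bullet> \<alpha>)) = 0"
    using assms(3) by (simp add: c inner_sum_right)
  then have *: "\<forall>\<alpha>\<in>\<Delta>. of_nat (c \<alpha>) * (x \<bullet> \<alpha>) = 0"
    by (subst (asm) sum_nonneg_eq_0_iff) (auto simp: finite_simple assms(2))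
  have "of_nat (c \<alpha>) *\<^sub>R \<alpha> = (if \<alpha> = \<gamma> then of_nat (c \<gamma>) *\<^sub>R \<gamma> else 0)" if "\<alpha> \<in> \<Delta>" for \<alpha>
    using * assms(4)[of \<alpha>] that by (cases "\<alpha> = \<gamma>") force+
  then have "\<beta> = (\<Sum>\<alpha>\<in>\<Delta>. if \<alpha> = \<gamma> then of_nat (c \<gamma>) *\<^sub>R \<gamma> else 0)"
    unfolding c by (rule sum.cong[OF refl])
  also have "\<dots> = of_nat (if \<gamma> \<in> \<Delta> then c \<gamma> else 0) *\<^sub>R \<gamma>"
    by (simp add: finite_simple sum.delta')
  finally show ?thesis by blast
qed

lemma cone_pos:
  assumes "\<beta> \<in> pos_cone" "\<And>\<alpha>. \<alpha> \<in> \<Delta> \<Longrightarrow> x \<bullet> \<alpha> > 0" "\<beta> \<noteq> 0" shows "x \<bullet> \<beta> > 0"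
proof -
  have "x \<bullet> \<beta> \<ge> 0" using assms(1,2) by (meson cone_nonneg less_imp_le)
  moreover have "x \<bullet> \<beta> \<noteq> 0"
    using cone_eq_zero_multiple[OF assms(1), of x 0] assms(2,3) by (auto simp: less_imp_le)
  ultimately show ?thesis by simp
qed

text \<open>Otherwise both - \<theta> and \<theta> - (- \<theta>) would lie in the cone, which a
  functional positive on the simple roots refutes.\<close>

lemma theta_cone: "\<theta> \<in> pos_cone"
proof (rule ccontr)
  assume "\<theta> \<notin> pos_cone"
  then have 1: "- \<theta> \<in> pos_cone" using root_cone_cases[OF theta_root] by blast
  have 2: "\<theta> - (- \<theta>) \<in> pos_cone" by (rule highest_root_cone[OF root_uminus[OF theta_root]])
  obtain x where x: "\<forall>\<alpha>\<in>\<Delta>. x \<bullet> \<alpha> = (1::real)"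
    using simple_dual_vector[of "\<lambda>_. 1"] by blast
  have "x \<bullet> (- \<theta>) > 0" using 1 root_nonzero[OF theta_root] x by - (rule cone_pos, auto)
  moreover have "x \<bullet> (\<theta> - (- \<theta>)) \<ge> 0" using 2 x by - (rule cone_nonneg, auto)
  ultimately show False by (simp add: inner_add_right)
qed

text \<open>The sum of the fundamental coweights, that is, half the sum of the positive coroots. The
  choice is unique because \<Delta> is a basis.\<close>

definition \<rho> :: 'a where "\<rho> = (SOME x. \<forall>\<alpha>\<in>\<Delta>. x \<bullet> \<alpha> = 1)"

text \<open>The Coxeter number.\<close>

definition h :: real where "h = \<rho> \<bullet> \<theta> + 1"

text \<open>An interior point of the alcove, on which every affine root takes a value in \<open>(1/h)\<int>\<close>.\<close>

definition p :: 'a where "p = (1 / h) *\<^sub>R \<rho>"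

lemma rho_simple: "\<alpha> \<in> \<Delta> \<Longrightarrow> \<rho> \<bullet> \<alpha> = 1"
  using someI_ex[OF simple_dual_vector[of "\<lambda>_. 1"]] by (simp add: \<rho>_def)

lemma rho_theta_pos: "\<rho> \<bullet> \<theta> > 0"
  using rho_simple by - (rule cone_pos[OF theta_cone], auto simp: root_nonzero theta_root)

lemma h_gt_1: "h > 1"
  using rho_theta_pos by (simp add: h_def)

lemma rho_cone_int: "\<beta> \<in> pos_cone \<Longrightarrow> \<rho> \<bullet> \<beta> \<in> \<int>"
  unfolding pos_cone_def by (auto simp: inner_sum_right rho_simple simp flip: of_nat_sum)

lemma rho_root_int: "\<beta> \<in> \<Phi> \<Longrightarrow> \<rho> \<bullet> \<beta> \<in> \<int>"
  by (erule root_cone_cases) (use rho_cone_int[of \<beta>] rho_cone_int[of "- \<beta>"] in simp_all)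

lemma h_aff_val_int: "r \<in> R \<Longrightarrow> h * aff_val r p \<in> \<int>"
proof -
  assume r: "r \<in> R"
  have "h \<in> \<int>" unfolding h_def by (intro Ints_add rho_root_int theta_root) auto
  moreover have "h * aff_val r p = \<rho> \<bullet> fst r + h * of_int (snd r)"
    using h_gt_1 by (simp add: aff_val_def p_def field_simps)
  moreover have "\<rho> \<bullet> fst r \<in> \<int>" using r by (auto intro: rho_root_int)
  ultimately show ?thesis by auto
qed

lemma p_simple: "\<alpha> \<in> \<Delta> \<Longrightarrow> p \<bullet> \<alpha> = 1 / h"
  by (simp add: p_def rho_simple)

lemma p_theta: "p \<bullet> \<theta> = 1 - 1 / h"
  using h_gt_1 by (simp add: p_def h_def field_simps)

section \<open>Signs of roots and affine roots on the alcove\<close>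

lemma A_iff: "x \<in> A \<longleftrightarrow> (\<forall>\<alpha>\<in>\<Delta>. x \<bullet> \<alpha> \<ge> 0) \<and> x \<bullet> \<theta> \<le> 1"
  by (simp add: fundamental_alcove_def)

lemma p_in_A: "p \<in> A"
  using h_gt_1 by (simp add: A_iff p_simple p_theta)

lemma root_cone_on_A:
  assumes "\<beta> \<in> \<Phi>" "\<beta> \<in> pos_cone" "x \<in> A"
  shows "0 \<le> x \<bullet> \<beta>" "x \<bullet> \<beta> \<le> 1"
proof -
  show "0 \<le> x \<bullet> \<beta>" using assms(3) by - (rule cone_nonneg[OF assms(2)], simp add: A_iff)
  have "0 \<le> x \<bullet> (\<theta> - \<beta>)" using assms(3) by - (rule cone_nonneg[OF highest_root_cone[OF assms(1)]], simp add: A_iff)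
  then show "x \<bullet> \<beta> \<le> 1" using assms by (simp add: inner_diff_right A_iff)
qed

lemma root_cone_at_p:
  assumes "\<beta> \<in> \<Phi>" "\<beta> \<in> pos_cone"
  shows "0 < p \<bullet> \<beta>" "p \<bullet> \<beta> < 1"
proof -
  have pos: "\<alpha> \<in> \<Delta> \<Longrightarrow> p \<bullet> \<alpha> > 0" for \<alpha> using h_gt_1 by (simp add: p_simple)
  show "0 < p \<bullet> \<beta>" using pos assms root_nonzero by - (rule cone_pos, auto)
  have "0 \<le> p \<bullet> (\<theta> - \<beta>)" using pos assms highest_root_cone by - (rule cone_nonneg, auto simp: less_imp_le)
  moreover have "p \<bullet> \<theta> < 1" using h_gt_1 by (simp add: p_theta)
  ultimately show "p \<bullet> \<beta> < 1" by (simp add: inner_diff_right)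
qed

text \<open>A positive root takes a value strictly between 0 and 1 at \<open>p\<close>, so the
  integer part decides the sign of an affine root there, and at integer part 0 the sign of the root
  does. In particular the value is never 0.\<close>

lemma aff_root_cases:
  assumes "r \<in> R"
  obtains "fst r \<in> pos_cone" "snd r \<ge> 0" "aff_val r p > 0"
  | "fst r \<in> pos_cone" "snd r < 0" "aff_val r p < 0"
  | "- fst r \<in> pos_cone" "snd r > 0" "aff_val r p > 0"
  | "- fst r \<in> pos_cone" "snd r \<le> 0" "aff_val r p < 0"
proof -
  have r: "fst r \<in> \<Phi>" "- fst r \<in> \<Phi>" using assms root_uminus by auto
  have cone: "fst r \<in> pos_cone \<or> - fst r \<in> pos_cone" using root_cone_cases[OF r(1)] by blast
  have int: "snd r \<ge> 0 \<or> snd r \<le> -1" "snd r \<ge> 1 \<or> snd r \<le> 0" by linarith+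
  consider "fst r \<in> pos_cone" "snd r \<ge> 0" | "fst r \<in> pos_cone" "snd r \<le> -1"
    | "- fst r \<in> pos_cone" "snd r \<ge> 1" | "- fst r \<in> pos_cone" "snd r \<le> 0"
    using cone int by blast
  then show ?thesis
  proof cases
    case 1 then show ?thesis using root_cone_at_p[OF r(1)] that(1) by (auto simp: aff_val_def)
  next
    case 2
    then have "real_of_int (snd r) \<le> -1" by linarith
    with 2 show ?thesis using root_cone_at_p[OF r(1)] that(2) by (auto simp: aff_val_def)
  next
    case 3
    then have "real_of_int (snd r) \<ge> 1" by linarith
    with 3 show ?thesis using root_cone_at_p[OF r(2)] that(3) by (auto simp: aff_val_def)
  next
    case 4
    then have "real_of_int (snd r) \<le> 0" by linarith
    with 4 show ?thesis using root_cone_at_p[OF r(2)] that(4) by (auto simp: aff_val_def)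
  qed
qed

lemma aff_root_uminus: "r \<in> R \<Longrightarrow> - r \<in> R"
  using root_uminus by (cases r) simp

lemma aff_val_p_nonzero: "r \<in> R \<Longrightarrow> aff_val r p \<noteq> 0"
  by (erule aff_root_cases) auto

text \<open>No reflecting hyperplane cuts through the alcove, since positive roots take values in
  [0, 1] on it. The sign at \<open>p\<close> thus governs all of \<open>A\<close>.\<close>

lemma aff_root_pos_on_A:
  assumes "r \<in> R" "aff_val r p > 0" "x \<in> A"
  shows "aff_val r x \<ge> 0"
  using assms(1)
proof (cases rule: aff_root_cases)
  case 1 then show ?thesis using assms root_cone_on_A[of "fst r" x] by (auto simp: aff_val_def)
next
  case 3
  then have "real_of_int (snd r) \<ge> 1" by linarith
  then show ?thesis using assms 3 root_cone_on_A[of "- fst r" x] root_uminus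
    by (auto simp: aff_val_def)
qed (use assms in auto)

text \<open>The affine simple roots, one per wall of the alcove and oriented inwards; the last one
  is the function 1 - x \<bullet> \<theta>.\<close>

definition S :: "('a \<times> int) set" where
  "S = (\<lambda>\<alpha>. (\<alpha>, 0)) ` \<Delta> \<union> {(- \<theta>, 1)}"

lemma S_subset_R: "S \<subseteq> R"
  using simple_root theta_root root_uminus by (auto simp: S_def)

lemma S_R: "s \<in> S \<Longrightarrow> s \<in> R"
  using S_subset_R by blast

lemma A_eq_S: "x \<in> A \<longleftrightarrow> (\<forall>s\<in>S. aff_val s x \<ge> 0)"
  by (auto simp: A_iff S_def aff_val_def)

lemma S_pos: "s \<in> S \<Longrightarrow> aff_val s p > 0"
  using h_gt_1 by (auto simp: S_def aff_val_def p_simple p_theta)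

text \<open>A wall pulled back along \<open>g\<close> is an affine root, nonnegative at
  \<open>p\<close> because \<open>g p \<in> A\<close>, hence positive there, hence nonnegative on
  \<open>A\<close>. The reverse inclusion runs the argument for the inverse.\<close>

lemma E_image_A:
  assumes "g \<in> E" "g p \<in> A"
  shows "g ` A = A"
proof
  show "g ` A \<subseteq> A"
  proof
    fix y assume "y \<in> g ` A"
    then obtain x where x: "x \<in> A" "y = g x" by auto
    have "aff_val s (g x) \<ge> 0" if s: "s \<in> S" for s
    proof -
      obtain r where r: "r \<in> R" "\<And>x. aff_val s (g x) = aff_val r x"
        by (rule E_pullback[OF assms(1) S_R[OF s]]) (rule that)
      have "aff_val r p \<ge> 0" using assms(2) s by (simp add: A_eq_S flip: r(2))
      then show ?thesis using aff_root_pos_on_A[OF r(1)] aff_val_p_nonzero[OF r(1)] x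
        by (auto simp: r(2))
    qed
    then show "y \<in> A" by (auto simp: x(2) A_eq_S)
  qed
  obtain g' where g': "g' \<in> E" "g \<circ> g' = id" "g' \<circ> g = id" using E_inverse[OF assms(1)] by blast
  show "A \<subseteq> g ` A"
  proof
    fix x assume x: "x \<in> A"
    have "aff_val s (g' x) \<ge> 0" if s: "s \<in> S" for s
    proof -
      obtain r where r: "r \<in> R" "\<And>x. aff_val s (g' x) = aff_val r x"
        by (rule E_pullback[OF g'(1) S_R[OF s]]) (rule that)
      \<comment> \<open>Here \<open>r\<close> is the wall \<open>s\<close> seen through
        \<open>g'\<close>, so its value at \<open>g p\<close> is that of \<open>s\<close> at
        \<open>p\<close>. Were \<open>r\<close> negative at \<open>p\<close>, then
        \<open>- r\<close> would be nonnegative on \<open>A\<close>, which contains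
        \<open>g p\<close>.\<close>
      have "aff_val r (g p) > 0"
        using S_pos[OF s] g'(3) by (simp add: fun_eq_iff flip: r(2))
      moreover have "- r \<in> R" using r(1) by (rule aff_root_uminus)
      ultimately have "\<not> aff_val (- r) p > 0"
        using aff_root_pos_on_A[of "- r" "g p"] assms(2) by (auto simp: aff_val_uminus)
      then have "aff_val r p > 0" using aff_val_p_nonzero[OF r(1)] by (simp add: aff_val_uminus)
      then show ?thesis using aff_root_pos_on_A[OF r(1)] x by (simp add: r(2))
    qed
    then have "g' x \<in> A" by (simp add: A_eq_S)
    moreover have "x = g (g' x)" using g'(2) by (simp add: fun_eq_iff)
    ultimately show "x \<in> g ` A" by blast
  qed
qed

section \<open>Simple affine reflections\<close>

text \<open>The witness lies in the relative interior of the facet of \<open>A\<close> cut out by \<open>s\<close>.\<close>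

lemma wall_point:
  assumes "s \<in> S"
  obtains c where "c \<in> A" "aff_val s c = 0"
    "\<And>r. r \<in> R \<Longrightarrow> aff_val r p > 0 \<Longrightarrow> aff_val r c = 0 \<Longrightarrow> r = s"
proof (cases "s = (- \<theta>, 1)")
  case True
  \<comment> \<open>Scaling \<rho> until it meets the wall of \<theta> keeps it strictly inside all
    the other walls.\<close>
  define c where "c = (1 / (\<rho> \<bullet> \<theta>)) *\<^sub>R \<rho>"
  have c_simple: "\<alpha> \<in> \<Delta> \<Longrightarrow> c \<bullet> \<alpha> > 0" for \<alpha> using rho_theta_pos by (simp add: c_def rho_simple)
  have c_theta: "c \<bullet> \<theta> = 1" using rho_theta_pos by (simp add: c_def)
  have c_root: "0 < c \<bullet> \<beta>" if "\<beta> \<in> \<Phi>" "\<beta> \<in> pos_cone" for \<beta>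
    using that c_simple root_nonzero by - (rule cone_pos, auto)
  have cA: "c \<in> A" using c_simple c_theta by (auto simp: A_iff less_imp_le)
  show ?thesis
  proof
    fix r assume r: "r \<in> R" "aff_val r p > 0" "aff_val r c = 0"
    then have rr: "fst r \<in> \<Phi>" "- fst r \<in> \<Phi>" using root_uminus by auto
    from r(1) show "r = s"
    proof (cases rule: aff_root_cases)
      case 1 then show ?thesis using c_root[OF rr(1)] r by (simp add: aff_val_def)
    next
      case 3
      have "c \<bullet> (- fst r) \<le> 1" using root_cone_on_A[OF rr(2) 3(1) cA] by simp
      then have m: "snd r = 1" using 3 r(3) by (simp add: aff_val_def)
      then have "c \<bullet> (\<theta> - (- fst r)) = 0" using r(3) c_theta by (simp add: aff_val_def inner_diff_right inner_add_right)
      then have "\<theta> - (- fst r) = 0"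
        using cone_pos[OF highest_root_cone[OF rr(2)], of c] c_simple by force
      then have "fst r = - \<theta>" by (simp add: eq_neg_iff_add_eq_0 add.commute)
      then show ?thesis using m True by (simp add: prod_eq_iff)
    qed (use r in auto)
  qed (use cA c_theta True in \<open>auto simp: aff_val_def\<close>)
next
  case False
  then obtain \<gamma> where \<gamma>: "\<gamma> \<in> \<Delta>" "s = (\<gamma>, 0)" using assms by (auto simp: S_def)
  obtain y where y: "\<forall>\<alpha>\<in>\<Delta>. y \<bullet> \<alpha> = (if \<alpha> = \<gamma> then 0 else 1)"
    using simple_dual_vector[of "\<lambda>\<alpha>. if \<alpha> = \<gamma> then 0 else 1"] by blast
  have y_theta: "y \<bullet> \<theta> \<ge> 0" using y by - (rule cone_nonneg[OF theta_cone], auto)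
  \<comment> \<open>\<open>y\<close> is the sum of the fundamental coweights other than that of
    \<gamma>. The summand 1 forces \<open>c \<bullet> \<theta> < 1\<close> and avoids a division by
    zero in rank one, where \<open>y\<close> is 0.\<close>
  define c where "c = (1 / (y \<bullet> \<theta> + 1)) *\<^sub>R y"
  have c_simple: "\<alpha> \<in> \<Delta> \<Longrightarrow> c \<bullet> \<alpha> \<ge> 0" "\<alpha> \<in> \<Delta> \<Longrightarrow> \<alpha> \<noteq> \<gamma> \<Longrightarrow> c \<bullet> \<alpha> > 0" for \<alpha>
    using y_theta y by (auto simp: c_def)
  have c_theta: "c \<bullet> \<theta> < 1" using y_theta by (simp add: c_def field_simps)
  have c_\<gamma>: "c \<bullet> \<gamma> = 0" using y \<gamma> by (simp add: c_def)
  have cA: "c \<in> A" using c_simple c_theta by (auto simp: A_iff less_imp_le)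
  have c_root: "c \<bullet> \<beta> < 1" if "\<beta> \<in> \<Phi>" for \<beta>
    using cone_nonneg[OF highest_root_cone[OF that], of c] c_simple c_theta
    by (simp add: inner_diff_right)
  have eq: "\<beta> = \<gamma>" if \<beta>: "\<beta> \<in> \<Phi>" "\<beta> \<in> pos_cone" "c \<bullet> \<beta> = 0" for \<beta>
  proof -
    obtain n :: nat where n: "\<beta> = of_nat n *\<^sub>R \<gamma>"
      using cone_eq_zero_multiple[OF \<beta>(2) _ \<beta>(3)] c_simple by blast
    \<comment> \<open>The root system is reduced, so the natural multiple \<open>n\<close> can only
      be 1.\<close>
    then show ?thesis using root_scaleR[OF simple_root[OF \<gamma>(1)], of "of_nat n"] \<beta>(1) by auto
  qed
  show ?thesis
  proof
    fix r assume r: "r \<in> R" "aff_val r p > 0" "aff_val r c = 0"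
    then have rr: "fst r \<in> \<Phi>" "- fst r \<in> \<Phi>" using root_uminus by auto
    from r(1) show "r = s"
    proof (cases rule: aff_root_cases)
      case 1
      then have "c \<bullet> fst r = 0" "snd r = 0"
        using r(3) root_cone_on_A[OF rr(1) 1(1) cA] by (auto simp: aff_val_def)
      then show ?thesis using eq[OF rr(1) 1(1)] \<gamma> by (simp add: prod_eq_iff)
    next
      case 3
      then have "real_of_int (snd r) \<ge> 1" by linarith
      then show ?thesis using c_root[OF rr(2)] r(3) by (simp add: aff_val_def)
    qed (use r in auto)
  qed (use cA c_\<gamma> \<gamma> in \<open>auto simp: aff_val_def\<close>)
qed

text \<open>The reflection in \<open>s\<close> fixes the facet point \<open>c\<close>, so
  \<open>r\<close> and \<open>r'\<close> agree there. If \<open>r'\<close> were negative at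
  \<open>p\<close>, this common value would be both nonnegative and nonpositive, hence 0, and only
  \<open>s\<close> vanishes at \<open>c\<close> among the positive affine roots.\<close>

lemma simple_reflection_pos:
  assumes "s \<in> S" "r \<in> R" "aff_val r p > 0" "r \<noteq> s"
    "r' \<in> R" "\<And>x. aff_val r (aff_reflection s x) = aff_val r' x"
  shows "aff_val r' p > 0"
proof (rule ccontr)
  assume "\<not> aff_val r' p > 0"
  then have neg: "aff_val (- r') p > 0" using aff_val_p_nonzero[OF assms(5)] by (simp add: aff_val_uminus)
  obtain c where c: "c \<in> A" "aff_val s c = 0"
    "\<And>r. r \<in> R \<Longrightarrow> aff_val r p > 0 \<Longrightarrow> aff_val r c = 0 \<Longrightarrow> r = s"
    using wall_point[OF assms(1)] by blast
  have "- r' \<in> R" using assms(5) by (rule aff_root_uminus)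
  then have "aff_val (- r') c \<ge> 0" by (rule aff_root_pos_on_A[OF _ neg c(1)])
  moreover have "aff_val r' c = aff_val r c" using assms(6)[of c] by (simp add: aff_reflection_fix c(2))
  moreover have "aff_val r c \<ge> 0" by (rule aff_root_pos_on_A[OF assms(2,3) c(1)])
  ultimately have "aff_val r c = 0" by (simp add: aff_val_uminus)
  then show False using c(3)[OF assms(2,3)] assms(4) by blast
qed

text \<open>If \<beta> has no positive product with a simple root, pairing - \<beta> with the cone
  element \<theta> + \<beta> gives \<beta> \<bullet> (- \<theta>) \<ge> \<beta> \<bullet> \<beta> >
  0, so the affine wall serves.\<close>

lemma simple_descent:
  assumes "\<beta> \<in> \<Phi>" obtains s where "s \<in> S" "\<beta> \<bullet> fst s > 0"
proof (cases "\<exists>\<alpha>\<in>\<Delta>. \<beta> \<bullet> \<alpha> > 0")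
  case True
  then obtain \<alpha> where "\<alpha> \<in> \<Delta>" "\<beta> \<bullet> \<alpha> > 0" by blast
  then show ?thesis using that[of "(\<alpha>, 0)"] by (simp add: S_def)
next
  case False
  have "\<theta> - (- \<beta>) \<in> pos_cone" using highest_root_cone[OF root_uminus[OF assms]] .
  then have "(- \<beta>) \<bullet> (\<theta> - (- \<beta>)) \<ge> 0" using False by - (rule cone_nonneg, auto simp: not_less)
  moreover have "\<beta> \<bullet> \<beta> > 0" using root_nonzero[OF assms] by simp
  ultimately have "\<beta> \<bullet> (- \<theta>) > 0" by (simp only: inner_diff_right inner_minus_left inner_minus_right)
  then show ?thesis using that[of "(- \<theta>, 1)"] by (simp add: S_def)
qed

section \<open>Words in the simple affine reflections\<close>

text \<open>This is the affine Weyl group, as \<open>weyl_words\<close>,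
  \<open>translation_words\<close> and \<open>words_form\<close> show together. It is presented by
  words because the exchange argument inducts on their length.\<close>

definition words :: "('a \<Rightarrow> 'a) set" where
  "words = word ` {rs. set rs \<subseteq> S}"

lemma wordsI: "set rs \<subseteq> S \<Longrightarrow> word rs \<in> words"
  by (simp add: words_def)

lemma words_id: "id \<in> words"
  using wordsI[of "[]"] by (simp only: word_Nil) simp

lemma words_comp: "f \<in> words \<Longrightarrow> g \<in> words \<Longrightarrow> f \<circ> g \<in> words"
  unfolding words_def by (auto simp flip: word_append simp: image_iff) (metis le_sup_iff set_append)

lemma words_simple: "s \<in> S \<Longrightarrow> aff_reflection s \<in> words"
  using wordsI[of "[s]"] by (simp add: word_Cons)

lemma words_E: "g \<in> words \<Longrightarrow> g \<in> E"
  unfolding words_def using word_E S_subset_R by blast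

lemma words_inverse:
  assumes "f \<in> words" obtains g where "g \<in> words" "f \<circ> g = id" "g \<circ> f = id"
proof -
  have "word (rev rs) \<circ> word rs = id" if "set rs \<subseteq> S" for rs
    using that
  proof (induction rs)
    case (Cons r rs)
    then have "aff_reflection r \<circ> aff_reflection r = id"
      using S_subset_R aff_root_nonzero by (intro aff_reflection_involution) auto
    then have "word (rev (r # rs)) \<circ> word (r # rs) = word (rev rs) \<circ> id \<circ> word rs"
      by (simp add: word_append word_Cons comp_assoc) (simp add: comp_assoc[symmetric])
    then show ?case using Cons by simp
  qed simp
  note * = this
  obtain rs where rs: "set rs \<subseteq> S" "f = word rs" using assms by (auto simp: words_def)
  have "word (rev rs) \<in> words" using rs by (intro wordsI) simp
  then show ?thesis using that *[of rs] *[of "rev rs"] rs by simp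
qed

text \<open>Conjugating by a wall with positive inner product lowers the value at \<open>p\<close>
  of a positive affine root, which stays positive unless it is that wall. Times \<open>h\<close>
  these values are positive integers, so the descent ends at a wall.\<close>

lemma aff_reflection_words:
  assumes "r \<in> R" shows "aff_reflection r \<in> words"
proof -
  have pos: "aff_reflection r \<in> words" if "r \<in> R" "aff_val r p > 0" for r
    using that
  proof (induction "nat \<lfloor>h * aff_val r p\<rfloor>" arbitrary: r rule: less_induct)
    case less
    show ?case
    proof (cases "r \<in> S")
      case True then show ?thesis by (rule words_simple)
    next
      case False
      obtain s where s: "s \<in> S" "fst r \<bullet> fst s > 0"
        by (rule simple_descent[of "fst r"]) (use less.prems in auto)
      have sR: "s \<in> R" using s S_subset_R by auto
      obtain r' where r': "r' \<in> R" "\<And>x. aff_val r (aff_reflection s x) = aff_val r' x"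
        "aff_reflection r \<circ> aff_reflection s = aff_reflection s \<circ> aff_reflection r'"
        by (rule E_pullback[OF aff_reflection_E[OF sR] less.prems(1)]) (rule that)
      have r'_pos: "aff_val r' p > 0"
        using simple_reflection_pos[OF s(1) less.prems _ r'(1,2)] False s(1) by blast
      have "fst s \<bullet> fst s > 0" using aff_root_nonzero[OF sR] by simp
      then have "coroot (fst s) \<bullet> fst r > 0" using s(2) by (simp add: coroot_def inner_commute)
      moreover have "aff_val r' p = aff_val r p - aff_val s p * (coroot (fst s) \<bullet> fst r)"
        unfolding r'(2)[symmetric] aff_reflection_def by (simp add: aff_val_def[of r] inner_diff_left)
      ultimately have "aff_val r' p < aff_val r p" using S_pos[OF s(1)] by simp
      then have "h * aff_val r' p < h * aff_val r p" using h_gt_1 by simp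
      moreover have "h * aff_val r' p \<in> \<int>" "h * aff_val r p \<in> \<int>"
        using h_aff_val_int r'(1) less.prems(1) by auto
      moreover have "h * aff_val r' p > 0" using h_gt_1 r'_pos by simp
      ultimately have "nat \<lfloor>h * aff_val r' p\<rfloor> < nat \<lfloor>h * aff_val r p\<rfloor>"
        by (auto elim!: Ints_cases)
      then have "aff_reflection r' \<in> words" by (rule less.hyps[OF _ r'(1) r'_pos])
      then have "aff_reflection s \<circ> aff_reflection r' \<circ> aff_reflection s \<in> words"
        by (intro words_comp words_simple[OF s(1)])
      also have "aff_reflection s \<circ> aff_reflection r' \<circ> aff_reflection s =
          aff_reflection r \<circ> (aff_reflection s \<circ> aff_reflection s)"
        by (simp only: r'(3)[symmetric] comp_assoc)
      finally show ?thesis using aff_reflection_involution[OF aff_root_nonzero[OF sR]] by simp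
    qed
  qed
  show ?thesis
  proof (cases "aff_val r p > 0")
    case True then show ?thesis by (rule pos[OF assms])
  next
    case False
    then have "aff_val (- r) p > 0" using aff_val_p_nonzero[OF assms] by (simp add: aff_val_uminus)
    moreover have "- r \<in> R" using assms by (rule aff_root_uminus)
    ultimately show ?thesis using pos[of "- r"] by (simp add: aff_reflection_uminus)
  qed
qed

lemma weyl_words: "w \<in> W \<Longrightarrow> w \<in> words"
  by (induction rule: weyl_induct)
    (auto simp only: words_id words_comp reflection_eq_aff_reflection intro!: aff_reflection_words)

lemma translation_words: "q \<in> Q \<Longrightarrow> translation q \<in> words"
  unfolding coroot_lattice_def
proof (induction rule: group_closure.induct)
  case (base q)
  \<comment> \<open>The base elements of a group closure are the generators together with 0.\<close>
  consider "q = 0" | \<alpha> where "\<alpha> \<in> \<Phi>" "q = coroot \<alpha>" using base by auto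
  then show ?case
  proof cases
    case 1
    then have "translation q = id" by (simp add: fun_eq_iff translation_def)
    then show ?thesis by (simp only: words_id)
  next
    case 2
    \<comment> \<open>Reflecting in the parallel hyperplanes at heights 0 and 1 of \<alpha> amounts
      to translating by the coroot.\<close>
    have "translation q \<circ> (reflection \<alpha> \<circ> reflection \<alpha>) = aff_reflection (\<alpha>, -1) \<circ> aff_reflection (\<alpha>, 0)"
      by (simp add: aff_reflection_eq_translation[of _ "-1"] 2 comp_assoc reflection_eq_aff_reflection)
    then have "translation q = aff_reflection (\<alpha>, -1) \<circ> aff_reflection (\<alpha>, 0)"
      by (simp add: reflection_involution 2)
    also have "\<dots> \<in> words" using 2 by (intro words_comp aff_reflection_words) auto
    finally show ?thesis .
  qed
next
  case (diff q q')
  obtain g where g: "g \<in> words" "translation q' \<circ> g = id" using words_inverse[OF diff(4)] by blast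
  have "translation (q - q') = translation q \<circ> g"
  proof
    fix x
    have "g x = x - q'" using g(2) by (simp add: fun_eq_iff translation_def eq_diff_eq)
    then show "translation (q - q') x = (translation q \<circ> g) x" by (simp add: translation_def)
  qed
  then show ?case using words_comp[OF diff(3) g(1)] by (simp only:)
qed

text \<open>Pushing a reflection past a translation changes its vector only by an element of Q,
  because W acts trivially on L/Q.\<close>

lemma words_form:
  assumes "g \<in> words" obtains q w where "q \<in> Q" "w \<in> W" "g = translation q \<circ> w"
proof -
  have "\<exists>q\<in>Q. \<exists>w\<in>W. word rs = translation q \<circ> w" if "set rs \<subseteq> R" for rs
    using that
  proof (induction rs)
    case Nil
    have "word [] = translation 0 \<circ> id" by (simp add: fun_eq_iff translation_def)
    then show ?case using Q_zero weyl_id by blast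
  next
    case (Cons r rs)
    then obtain q w where qw: "q \<in> Q" "w \<in> W" "word rs = translation q \<circ> w"
      by (meson list.set_intros(2) subset_iff)
    obtain \<beta> m where r: "r = (\<beta>, m)" "\<beta> \<in> \<Phi>" using Cons by auto
    have "word (r # rs) = translation (- of_int m *\<^sub>R coroot \<beta> + reflection \<beta> q) \<circ> (reflection \<beta> \<circ> w)"
      by (simp only: word_Cons qw(3) r(1) aff_reflection_eq_translation
          translation_weyl_comp[OF weyl_reflection[OF r(2)]])
    moreover have "reflection \<beta> \<circ> w \<in> W" using r qw by (simp add: weyl_comp weyl_reflection)
    moreover have "reflection \<beta> q - q + q \<in> Q"
      using weyl_Q[OF weyl_reflection[OF r(2)]] qw(1) Q_subset_L by (blast intro: Q_add)
    then have "- of_int m *\<^sub>R coroot \<beta> + reflection \<beta> q \<in> Q"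
      using Q_add[OF Q_int_mult[OF Q_coroot[OF r(2)], of "- m"]] by simp
    ultimately show ?case by blast
  qed
  moreover obtain rs where "set rs \<subseteq> S" "g = word rs" using assms by (auto simp: words_def)
  ultimately show ?thesis using that S_subset_R by blast
qed

section \<open>Simple transitivity on alcoves\<close>

text \<open>The integers \<open>h * (y \<bullet> \<alpha>)\<close> determine \<open>y\<close>, since
  \<Delta> spans, and lie in a finite box by Cauchy-Schwarz. This supplies the closest orbit point
  in \<open>words_into_A\<close>.\<close>

lemma finite_bounded_lattice:
  "finite {y. (\<forall>\<alpha>\<in>\<Delta>. h * (y \<bullet> \<alpha>) \<in> \<int>) \<and> norm (y - p) \<le> C}" (is "finite ?Y")
proof -
  define F where "F y = restrict (\<lambda>\<alpha>. \<lfloor>h * (y \<bullet> \<alpha>)\<rfloor>) \<Delta>" for y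
  define K where "K \<alpha> = h * ((C + norm p) * norm \<alpha>)" for \<alpha> :: 'a
  have "inj_on F ?Y"
  proof
    fix x y assume xy: "x \<in> ?Y" "y \<in> ?Y" "F x = F y"
    have eq: "(x - y) \<bullet> \<alpha> = 0" if "\<alpha> \<in> \<Delta>" for \<alpha>
    proof -
      have "\<lfloor>h * (x \<bullet> \<alpha>)\<rfloor> = \<lfloor>h * (y \<bullet> \<alpha>)\<rfloor>"
        using fun_cong[OF xy(3), of \<alpha>] that by (simp add: F_def)
      moreover have "h * (x \<bullet> \<alpha>) \<in> \<int>" "h * (y \<bullet> \<alpha>) \<in> \<int>" using xy that by auto
      ultimately have "h * (x \<bullet> \<alpha>) = h * (y \<bullet> \<alpha>)"
        by (metis Ints_cases floor_of_int)
      then show ?thesis using h_gt_1 by (simp add: inner_diff_left)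
    qed
    have "x - y \<in> span \<Delta>" using simple_roots by (simp add: simple_roots_def)
    then have "orthogonal (x - y) (x - y)"
      by (rule orthogonal_to_span) (simp add: orthogonal_def eq)
    then show "x = y" by (simp add: orthogonal_def)
  qed
  moreover have "F ` ?Y \<subseteq> (\<Pi>\<^sub>E \<alpha>\<in>\<Delta>. {\<lfloor>- K \<alpha>\<rfloor>..\<lfloor>K \<alpha>\<rfloor>})"
  proof
    fix f assume "f \<in> F ` ?Y"
    then obtain y where y: "norm (y - p) \<le> C" "f = F y" by auto
    have "norm y \<le> C + norm p" using y(1) norm_triangle_sub[of y p] by simp
    then have "\<bar>y \<bullet> \<alpha>\<bar> \<le> (C + norm p) * norm \<alpha>" for \<alpha>
      using Cauchy_Schwarz_ineq2[of y \<alpha>] by (meson mult_right_mono norm_ge_zero order_trans)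
    then have "\<bar>h * (y \<bullet> \<alpha>)\<bar> \<le> K \<alpha>" for \<alpha>
      using h_gt_1 by (simp add: K_def abs_mult)
    then have "- K \<alpha> \<le> h * (y \<bullet> \<alpha>)" "h * (y \<bullet> \<alpha>) \<le> K \<alpha>" for \<alpha>
      by (simp_all add: abs_le_iff minus_le_iff)
    then have "\<lfloor>- K \<alpha>\<rfloor> \<le> \<lfloor>h * (y \<bullet> \<alpha>)\<rfloor>" "\<lfloor>h * (y \<bullet> \<alpha>)\<rfloor> \<le> \<lfloor>K \<alpha>\<rfloor>" for \<alpha>
      by (simp_all only: floor_mono)
    then show "f \<in> (\<Pi>\<^sub>E \<alpha>\<in>\<Delta>. {\<lfloor>- K \<alpha>\<rfloor>..\<lfloor>K \<alpha>\<rfloor>})" by (simp add: y(2) F_def)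
  qed
  ultimately show ?thesis
    using finite_simple by (meson finite_PiE finite_atLeastAtMost_int inj_on_finite)
qed

text \<open>In the orbit of \<open>g p\<close>, the point closest to \<open>p\<close> lies in \<open>A\<close>: reflecting it in a wall
  separating it from \<open>p\<close> would bring it closer.\<close>

lemma words_into_A:
  assumes "g \<in> E" shows "\<exists>f\<in>words. f (g p) \<in> A"
proof -
  define C where "C = norm (g p - p)"
  \<comment> \<open>Cutting the orbit off at the distance of \<open>g p\<close> makes it finite and
    leaves it nonempty.\<close>
  define B where "B = {y. (\<exists>f\<in>words. y = f (g p)) \<and> norm (y - p) \<le> C}"
  have "h * (f (g p) \<bullet> \<alpha>) \<in> \<int>" if "f \<in> words" "\<alpha> \<in> \<Delta>" for f \<alpha>
  proof -
    have "f \<circ> g \<in> E" using that assms words_E E_comp by blast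
    moreover have "(\<alpha>, 0) \<in> R" using that simple_root by simp
    ultimately obtain r where "r \<in> R" "\<And>x. aff_val (\<alpha>, 0) ((f \<circ> g) x) = aff_val r x"
      by (rule E_pullback) (rule that)
    then show ?thesis using h_aff_val_int[of r] by (simp add: aff_val_def)
  qed
  then have "B \<subseteq> {y. (\<forall>\<alpha>\<in>\<Delta>. h * (y \<bullet> \<alpha>) \<in> \<int>) \<and> norm (y - p) \<le> C}"
    by (auto simp: B_def)
  then have "finite B" using finite_bounded_lattice finite_subset by blast
  moreover have "g p \<in> B" using words_id by (auto simp: B_def C_def intro!: bexI[of _ id])
  ultimately obtain y where "is_arg_min (\<lambda>y. norm (y - p)) (\<lambda>y. y \<in> B) y"
    using ex_is_arg_min_if_finite by blast
  then have y: "y \<in> B" "\<And>z. z \<in> B \<Longrightarrow> norm (y - p) \<le> norm (z - p)"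
    by (auto simp: is_arg_min_linorder)
  obtain f where f: "f \<in> words" "y = f (g p)" using y(1) by (auto simp: B_def)
  have "aff_val s y \<ge> 0" if s: "s \<in> S" for s
  proof (rule ccontr)
    assume neg: "\<not> aff_val s y \<ge> 0"
    have s0: "fst s \<noteq> 0" using s S_R aff_root_nonzero by blast
    have "4 * aff_val s y * aff_val s p / (fst s \<bullet> fst s) < 0"
      using neg S_pos[OF s] s0 by (simp add: divide_less_0_iff mult_less_0_iff)
    then have "(norm (aff_reflection s y - p))\<^sup>2 < (norm (y - p))\<^sup>2"
      by (simp add: norm_aff_reflection_diff[OF s0])
    then have less: "norm (aff_reflection s y - p) < norm (y - p)"
      by (rule power_less_imp_less_base) simp
    have "aff_reflection s \<circ> f \<in> words" by (intro words_comp words_simple[OF s] f)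
    moreover have "norm (y - p) \<le> C" using y(1) by (simp add: B_def)
    ultimately have "aff_reflection s y \<in> B"
      unfolding B_def using less f(2) by (intro CollectI conjI bexI[of _ "aff_reflection s \<circ> f"]) auto
    then show False using y(2) less by force
  qed
  then have "f (g p) \<in> A" by (simp add: A_eq_S f(2))
  then show ?thesis using f(1) by blast
qed

text \<open>A discrete intermediate value principle along the prefixes of a list; for the exchange
  argument any such crossing will do.\<close>

lemma list_first_crossing:
  "\<not> P [] \<Longrightarrow> P xs \<Longrightarrow> \<exists>us x vs. xs = us @ x # vs \<and> \<not> P us \<and> P (us @ [x])"
proof (induction xs rule: rev_induct)
  case (snoc x xs)
  show ?case
  proof (cases "P xs")
    case True
    then obtain us y vs where "xs = us @ y # vs" "\<not> P us" "P (us @ [y])"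
      using snoc by blast
    then show ?thesis by (intro exI[of _ us] exI[of _ y] exI[of _ "vs @ [x]"]) simp
  next
    case False
    then show ?thesis using snoc.prems by (intro exI[of _ xs] exI[of _ x] exI[of _ "[]"]) simp
  qed
qed simp

text \<open>The exchange argument: the gallery described by a word fixing \<open>A\<close> crosses its first wall
  a second time, and deleting the two crossings shortens the word.\<close>

lemma word_fixing_A:
  "set rs \<subseteq> S \<Longrightarrow> word rs p \<in> A \<Longrightarrow> word rs = id"
proof (induction "length rs" arbitrary: rs rule: less_induct)
  case less
  show ?case
  proof (cases rs)
    case (Cons r ws)
    \<comment> \<open>\<open>P xs\<close> says that the alcove reached after \<open>r # xs\<close>
      is on the side of the wall \<open>r\<close> that contains \<open>p\<close>. The first letter
      leaves this side, and the whole word, which ends in \<open>A\<close>, has returned to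
      it.\<close>
    define P where "P xs \<longleftrightarrow> aff_val r (word (r # xs) p) > 0" for xs
    have r: "r \<in> S" "r \<in> R" and ws: "set ws \<subseteq> S" using less.prems Cons S_R by auto
    have "\<not> P []"
      using S_pos[OF r(1)] aff_val_aff_reflection_self[OF aff_root_nonzero[OF r(2)]]
      by (simp add: P_def word_Cons)
    moreover have "P ws"
    proof -
      have "word rs \<in> E" using less.prems(1) S_subset_R by (intro word_E) blast
      then obtain r' where "r' \<in> R" "\<And>x. aff_val r (word rs x) = aff_val r' x"
        using r(2) by (rule E_pullback) (rule that)
      then have "aff_val r (word rs p) \<noteq> 0" using aff_val_p_nonzero by simp
      moreover have "aff_val r (word rs p) \<ge> 0" using less.prems(2) r(1) by (simp add: A_eq_S)
      ultimately show ?thesis by (simp add: P_def Cons)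
    qed
    ultimately obtain us s vs where split: "ws = us @ s # vs" "\<not> P us" "P (us @ [s])"
      using list_first_crossing[of P ws] by blast
    define g where "g = word (r # us)"
    have s: "s \<in> S" "s \<in> R" and us: "set (r # us) \<subseteq> S" "set (us @ vs) \<subseteq> S"
      using ws split r S_R by auto
    have "g \<in> E" unfolding g_def using us S_subset_R by (intro word_E) blast
    then obtain r' where r': "r' \<in> R" "\<And>x. aff_val r (g x) = aff_val r' x"
      "aff_reflection r \<circ> g = g \<circ> aff_reflection r'"
      using r(2) by (rule E_pullback) (rule that)
    have pos: "aff_val (- r') p > 0"
      using split(2) aff_val_p_nonzero[OF r'(1)] by (simp add: P_def r'(2) aff_val_uminus flip: g_def)
    have "word (r # us @ [s]) p = g (aff_reflection s p)"
      by (simp add: g_def word_Cons word_append)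
    then have neg: "aff_val (- r') (aff_reflection s p) < 0"
      using split(3) by (simp add: P_def r'(2) aff_val_uminus)
    \<comment> \<open>\<open>- r'\<close> is positive at \<open>p\<close> and negative after
      reflecting in \<open>s\<close>; the only positive affine root with this behaviour is
      \<open>s\<close> itself.\<close>
    have "- r' = s"
    proof (rule ccontr)
      assume ne: "- r' \<noteq> s"
      obtain r'' where r'': "r'' \<in> R" "\<And>x. aff_val (- r') (aff_reflection s x) = aff_val r'' x"
        by (rule E_pullback[OF aff_reflection_E[OF s(2)] aff_root_uminus[OF r'(1)]]) (rule that)
      have "aff_val r'' p > 0"
        by (rule simple_reflection_pos[OF s(1) aff_root_uminus[OF r'(1)] pos ne r''])
      then show False using neg by (simp add: r''(2))
    qed
    then have "aff_reflection r' = aff_reflection s" using aff_reflection_uminus[of r'] by simp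
    have inv: "aff_reflection r \<circ> aff_reflection r = id"
      by (rule aff_reflection_involution[OF aff_root_nonzero[OF r(2)]])
    \<comment> \<open>The crossing letter \<open>s\<close>, carried to the front through
      \<open>g\<close>, becomes a second \<open>r\<close> and cancels the first one. The word loses
      two letters.\<close>
    have "word rs = g \<circ> aff_reflection s \<circ> word vs"
      by (simp add: Cons split(1) g_def word_Cons word_append comp_assoc)
    also have "g \<circ> aff_reflection s = aff_reflection r \<circ> g"
      using r'(3) \<open>aff_reflection r' = aff_reflection s\<close> by simp
    also have "aff_reflection r \<circ> g = word us"
      by (simp add: g_def word_Cons inv flip: comp_assoc)
    also have "word us \<circ> word vs = word (us @ vs)" by (simp add: word_append)
    finally have eq: "word rs = word (us @ vs)" .
    have "word (us @ vs) = id"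
      by (rule less.hyps) (use us less.prems(2) in \<open>simp_all add: Cons split(1) eq[symmetric]\<close>)
    then show ?thesis by (simp add: eq)
  qed simp
qed

section \<open>The group of alcove symmetries\<close>

abbreviation "Om \<equiv> Omega \<Phi> \<Delta> \<theta>"

lemma Omega_comp: "f \<in> Om \<Longrightarrow> g \<in> Om \<Longrightarrow> f \<circ> g \<in> Om"
  by (simp add: Omega_def E_comp image_comp[symmetric] del: o_apply)

lemma Omega_id: "id \<in> Om"
  by (simp add: Omega_def E_id)

lemma Omega_inverse:
  assumes "f \<in> Om" "g \<in> E" "g \<circ> f = id" shows "g \<in> Om"
proof -
  have "g ` A = g ` (f ` A)" using assms by (simp add: Omega_def)
  also have "\<dots> = A" using assms(3) by (simp only: image_comp image_id id_apply)
  finally show ?thesis using assms(2) by (simp add: Omega_def)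
qed

text \<open>Such an element is a word in the wall reflections and sends \<open>p\<close> into
  \<open>A\<close>, so the exchange argument applies.\<close>

lemma Omega_coroot_translation:
  assumes "\<mu> \<in> Q" "w \<in> W" "translation \<mu> \<circ> w \<in> Om"
  shows "translation \<mu> \<circ> w = id"
proof -
  have "translation \<mu> \<circ> w \<in> words"
    by (intro words_comp translation_words weyl_words assms)
  then obtain rs where rs: "set rs \<subseteq> S" "translation \<mu> \<circ> w = word rs" by (auto simp: words_def)
  have "word rs p \<in> A" using assms(3) p_in_A unfolding Omega_def rs(2) by blast
  then show ?thesis using word_fixing_A rs by simp
qed

text \<open>An affine Weyl element brings the translated alcove back to \<open>A\<close>. It changes
  the translation part \<mu> to q + w \<mu>, which has the same class modulo Q.\<close>

lemma Omega_coset: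
  assumes "\<mu> \<in> L"
  obtains \<nu> w where "\<nu> \<in> L" "w \<in> W" "translation \<nu> \<circ> w \<in> Om" "\<nu> - \<mu> \<in> Q"
proof -
  have g: "translation \<mu> \<circ> id \<in> E" by (intro E_I assms weyl_id)
  then obtain f where f: "f \<in> words" "f ((translation \<mu> \<circ> id) p) \<in> A" using words_into_A by blast
  obtain q w where qw: "q \<in> Q" "w \<in> W" "f = translation q \<circ> w" using f(1) by (rule words_form)
  have eq: "f \<circ> (translation \<mu> \<circ> id) = translation (q + w \<mu>) \<circ> w"
    using translation_weyl_comp[OF qw(2), of q \<mu> id] unfolding qw(3) by (simp only: comp_id)
  have "f \<circ> (translation \<mu> \<circ> id) \<in> E" by (rule E_comp[OF words_E[OF f(1)] g])
  then have "f \<circ> (translation \<mu> \<circ> id) \<in> Om"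
    using E_image_A[of "f \<circ> (translation \<mu> \<circ> id)"] f(2) by (simp only: Omega_def mem_Collect_eq comp_apply)
  moreover have "q + w \<mu> \<in> L" using qw Q_subset_L assms weyl_L by (intro L_add) auto
  moreover have "q + (w \<mu> - \<mu>) \<in> Q" by (intro Q_add weyl_Q qw assms)
  ultimately show ?thesis using that[of "q + w \<mu>" w] qw(2) unfolding eq by (simp add: algebra_simps)
qed

section \<open>Multiplication by b on the quotient L/Q\<close>

lemma coweight_comm_group: "comm_group (coweight_group \<Phi>)"
proof (rule comm_groupI)
  fix x assume "x \<in> carrier (coweight_group \<Phi>)"
  then show "\<exists>y\<in>carrier (coweight_group \<Phi>). y \<otimes>\<^bsub>coweight_group \<Phi>\<^esub> x = \<one>\<^bsub>coweight_group \<Phi>\<^esub>"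
    by (intro bexI[of _ "- x"]) (simp_all add: coweight_group_def L_uminus)
qed (simp_all add: coweight_group_def L_add L_zero algebra_simps)

text \<open>For an infinite index \<open>card\<close> gives \<open>0\<close>, and the statement is trivial.\<close>

lemma index_of_connection_mult:
  assumes "x \<in> L" shows "real (index_of_connection \<Phi>) *\<^sub>R x \<in> Q"
proof -
  let ?G = "coweight_group \<Phi>" and ?n = "index_of_connection \<Phi>"
  interpret G: comm_group ?G by (rule coweight_comm_group)
  have x: "x \<in> carrier ?G" using assms by (simp add: coweight_group_def)
  have inv: "inv\<^bsub>?G\<^esub> y = - y" if "y \<in> L" for y
    by (rule G.inv_equality) (use that L_uminus in \<open>simp_all add: coweight_group_def\<close>)
  have sub: "subgroup Q ?G"
  proof (rule G.subgroupI)
    show "Q \<subseteq> carrier ?G" using Q_subset_L by (simp add: coweight_group_def)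
    show "Q \<noteq> {}" using Q_zero by blast
    show "inv\<^bsub>?G\<^esub> y \<in> Q" if "y \<in> Q" for y using that inv[of y] Q_subset_L by (auto simp: Q_uminus)
    show "y \<otimes>\<^bsub>?G\<^esub> z \<in> Q" if "y \<in> Q" "z \<in> Q" for y z
      using that by (simp add: coweight_group_def Q_add)
  qed
  interpret N: normal Q ?G by (rule G.subgroup_imp_normal[OF sub])
  interpret F: group "?G Mod Q" by (rule N.factorgroup_is_group)
  have pow: "x [^]\<^bsub>?G\<^esub> n = real n *\<^sub>R x" for n :: nat
    by (induction n) (simp_all add: coweight_group_def scaleR_left_distrib add.commute)
  have order: "order (?G Mod Q) = ?n"
    by (simp add: order_def FactGroup_def index_of_connection_def)
  have "Q #>\<^bsub>?G\<^esub> x \<in> carrier (?G Mod Q)" using x by (auto simp: carrier_FactGroup)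
  \<comment> \<open>Lagrange's theorem in L/Q.\<close>
  from F.pow_order_eq_1[OF this] have "Q #>\<^bsub>?G\<^esub> (x [^]\<^bsub>?G\<^esub> ?n) = Q"
    by (simp add: order N.FactGroup_pow[OF x])
  then have "x [^]\<^bsub>?G\<^esub> ?n \<in> Q"
    by (rule G.coset_join1) (use x sub in simp_all)
  then show ?thesis by (simp add: pow)
qed

text \<open>The Bezout coefficient \<open>u\<close> inverts \<open>b\<close> modulo the index, and
  the index annihilates L/Q. This gives surjectivity of multiplication by \<open>b\<close>; the next
  lemma gives injectivity.\<close>

lemma coprime_index_multiple:
  assumes "coprime b (index_of_connection \<Phi>)"
  obtains u :: int where "\<And>x. x \<in> L \<Longrightarrow> x - real b *\<^sub>R (of_int u *\<^sub>R x) \<in> Q"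
proof -
  have "coprime (int b) (int (index_of_connection \<Phi>))" using assms by simp
  then obtain u v where uv: "u * int b + v * int (index_of_connection \<Phi>) = 1"
    using bezout_int[of "int b" "int (index_of_connection \<Phi>)"] by auto
  show ?thesis
  proof (rule that[of u])
    fix x assume x: "x \<in> L"
    have "real_of_int (u * int b + v * int (index_of_connection \<Phi>)) = 1" by (simp only: uv of_int_1)
    then have "1 - real b * real_of_int u = real_of_int v * real (index_of_connection \<Phi>)"
      by (simp add: algebra_simps)
    then have "x - real b *\<^sub>R (of_int u *\<^sub>R x) = of_int v *\<^sub>R (real (index_of_connection \<Phi>) *\<^sub>R x)"
      by (metis scaleR_left_diff_distrib scaleR_one scaleR_scaleR)
    then show "x - real b *\<^sub>R (of_int u *\<^sub>R x) \<in> Q"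
      using Q_int_mult[OF index_of_connection_mult[OF x], of v] by simp
  qed
qed

lemma coprime_index_cancel:
  assumes "coprime b (index_of_connection \<Phi>)" "x \<in> L" "real b *\<^sub>R x \<in> Q"
  shows "x \<in> Q"
proof -
  obtain u :: int where u: "\<And>x. x \<in> L \<Longrightarrow> x - real b *\<^sub>R (of_int u *\<^sub>R x) \<in> Q"
    by (rule coprime_index_multiple[OF assms(1)]) (rule that)
  have "of_int u *\<^sub>R (real b *\<^sub>R x) \<in> Q" using assms(3) by (rule Q_int_mult)
  then have "real b *\<^sub>R (of_int u *\<^sub>R x) \<in> Q" by (simp add: mult.commute)
  from Q_add[OF u[OF assms(2)] this] show ?thesis by simp
qed

section \<open>The dilated group\<close>

lemma translation_weyl_bij: "w \<in> W \<Longrightarrow> bij (translation \<mu> \<circ> w)"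
  using translation_weyl_inverse o_bij by blast

lemma dilated_OmegaE:
  assumes "g \<in> dilated_Omega b \<Phi> \<Delta> \<theta>"
  obtains \<mu> w where "\<mu> \<in> L" "w \<in> W" "translation \<mu> \<circ> w \<in> Om" "g = translation (real b *\<^sub>R \<mu>) \<circ> w"
  using assms unfolding dilated_Omega_def by blast

lemma dilated_OmegaI:
  "\<mu> \<in> L \<Longrightarrow> w \<in> W \<Longrightarrow> translation \<mu> \<circ> w \<in> Om \<Longrightarrow>
    translation (real b *\<^sub>R \<mu>) \<circ> w \<in> dilated_Omega b \<Phi> \<Delta> \<theta>"
  unfolding dilated_Omega_def by blast

lemma dilated_Omega_bij: "g \<in> dilated_Omega b \<Phi> \<Delta> \<theta> \<Longrightarrow> bij g"
  by (erule dilated_OmegaE) (simp only: translation_weyl_bij)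

text \<open>Dilating the translation part respects composition because scaling commutes with the
  linear map \<open>w\<close>.\<close>

lemma dilated_Omega_comp:
  assumes "g \<in> dilated_Omega b \<Phi> \<Delta> \<theta>" "g' \<in> dilated_Omega b \<Phi> \<Delta> \<theta>"
  shows "g \<circ> g' \<in> dilated_Omega b \<Phi> \<Delta> \<theta>"
proof -
  obtain \<mu> w where 1: "\<mu> \<in> L" "w \<in> W" "translation \<mu> \<circ> w \<in> Om" "g = translation (real b *\<^sub>R \<mu>) \<circ> w"
    using assms(1) by (rule dilated_OmegaE)
  obtain \<nu> v where 2: "\<nu> \<in> L" "v \<in> W" "translation \<nu> \<circ> v \<in> Om" "g' = translation (real b *\<^sub>R \<nu>) \<circ> v"
    using assms(2) by (rule dilated_OmegaE)
  have "translation (\<mu> + w \<nu>) \<circ> (w \<circ> v) \<in> Om"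
    using Omega_comp[OF 1(3) 2(3)] by (simp only: translation_weyl_comp[OF 1(2)])
  then have "translation (real b *\<^sub>R (\<mu> + w \<nu>)) \<circ> (w \<circ> v) \<in> dilated_Omega b \<Phi> \<Delta> \<theta>"
    using 1 2 by (intro dilated_OmegaI L_add weyl_comp) (simp_all add: weyl_L)
  moreover have "real b *\<^sub>R (\<mu> + w \<nu>) = real b *\<^sub>R \<mu> + w (real b *\<^sub>R \<nu>)"
    by (simp add: scaleR_right_distrib linear_cmul[OF weyl_linear[OF 1(2)]])
  ultimately show ?thesis unfolding 1(4) 2(4) by (simp only: translation_weyl_comp[OF 1(2)])
qed

lemma dilated_Omega_id: "id \<in> dilated_Omega b \<Phi> \<Delta> \<theta>"
proof -
  have "translation 0 \<circ> id = (id :: 'a \<Rightarrow> 'a)" by (simp add: fun_eq_iff translation_def)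
  then show ?thesis using dilated_OmegaI[OF L_zero weyl_id, of b] Omega_id by (simp only: scaleR_zero_right)
qed

lemma dilated_Omega_inverse:
  assumes "g \<in> dilated_Omega b \<Phi> \<Delta> \<theta>"
  shows "inv_into UNIV g \<in> dilated_Omega b \<Phi> \<Delta> \<theta>"
proof -
  obtain \<mu> w where g: "\<mu> \<in> L" "w \<in> W" "translation \<mu> \<circ> w \<in> Om" "g = translation (real b *\<^sub>R \<mu>) \<circ> w"
    using assms by (rule dilated_OmegaE)
  define v where "v = inv_into UNIV w"
  have v: "v \<in> W" "- v \<mu> \<in> L" using g weyl_inv weyl_L L_uminus by (auto simp: v_def)
  have "translation (- v \<mu>) \<circ> v \<in> Om"
    using translation_weyl_inverse(2)[OF g(2)] unfolding v_def[symmetric]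
    by (intro Omega_inverse[OF g(3)] E_I v)
  then have *: "translation (real b *\<^sub>R (- v \<mu>)) \<circ> v \<in> dilated_Omega b \<Phi> \<Delta> \<theta>"
    by (rule dilated_OmegaI[OF v(2,1)])
  have "real b *\<^sub>R (- v \<mu>) = - v (real b *\<^sub>R \<mu>)"
    by (simp add: linear_cmul[OF weyl_linear[OF v(1)]])
  with * have **: "translation (- v (real b *\<^sub>R \<mu>)) \<circ> v \<in> dilated_Omega b \<Phi> \<Delta> \<theta>" by simp
  have "inv_into UNIV g = translation (- v (real b *\<^sub>R \<mu>)) \<circ> v"
    using translation_weyl_inverse[OF g(2), of "real b *\<^sub>R \<mu>"] unfolding g(4) v_def
    by (rule inv_unique_comp)
  with ** show ?thesis by simp
qed

lemma dilated_Omega_subgroup: "subgroup (dilated_Omega b \<Phi> \<Delta> \<theta>) (BijGroup UNIV)"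
proof (rule group.subgroupI[OF group_BijGroup])
  show "dilated_Omega b \<Phi> \<Delta> \<theta> \<subseteq> carrier (BijGroup UNIV)"
    using dilated_Omega_bij by (auto simp: carrier_BijGroup_UNIV)
  show "dilated_Omega b \<Phi> \<Delta> \<theta> \<noteq> {}" using dilated_Omega_id by blast
qed (simp_all only: inv_BijGroup_UNIV mult_BijGroup_UNIV dilated_Omega_bij dilated_Omega_inverse
    dilated_Omega_comp)

lemma dilated_Omega_L:
  assumes "g \<in> dilated_Omega b \<Phi> \<Delta> \<theta>" "x \<in> L" shows "g x \<in> L"
proof -
  obtain \<mu> w where "\<mu> \<in> L" "w \<in> W" "g = translation (real b *\<^sub>R \<mu>) \<circ> w"
    using assms(1) by (rule dilated_OmegaE)
  then show ?thesis using assms(2) by (simp add: translation_def L_add L_nat_mult weyl_L)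
qed

lemma dilated_Omega_bij_L:
  assumes g: "g \<in> dilated_Omega b \<Phi> \<Delta> \<theta>" shows "bij_betw g L L"
proof (rule bij_betw_byWitness[where f' = "inv_into UNIV g"])
  show "\<forall>x\<in>L. inv_into UNIV g (g x) = x" "\<forall>x\<in>L. g (inv_into UNIV g x) = x"
    using dilated_Omega_bij[OF g] by (auto simp: bij_is_inj bij_is_surj surj_f_inv_f)
  show "g ` L \<subseteq> L" "inv_into UNIV g ` L \<subseteq> L"
    using dilated_Omega_L[OF g] dilated_Omega_L[OF dilated_Omega_inverse[OF g]] by auto
qed

section \<open>The action on the coweight lattice\<close>

abbreviation "BO b \<equiv> dilated_Omega_group b \<Phi> \<Delta> \<theta>"

lemma carrier_BO: "carrier (BO b) = dilated_Omega b \<Phi> \<Delta> \<theta>"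
  by (simp add: dilated_Omega_group_def)

lemma group_BO: "group (BO b)"
  unfolding dilated_Omega_group_def
  by (rule subgroup.subgroup_is_group[OF dilated_Omega_subgroup group_BijGroup])

lemma lattice_action_Bij: "g \<in> dilated_Omega b \<Phi> \<Delta> \<theta> \<Longrightarrow> lattice_action \<Phi> g \<in> Bij L"
  by (simp add: lattice_action_def Bij_def dilated_Omega_bij_L)

lemma lattice_action_apply: "x \<in> L \<Longrightarrow> lattice_action \<Phi> g x = g x"
  by (simp add: lattice_action_def)

lemma group_action_BO: "group_action (BO b) L (lattice_action \<Phi>)"
proof (intro group_action.intro group_hom.intro group_hom_axioms.intro group_BO group_BijGroup homI)
  fix f g assume "f \<in> carrier (BO b)" "g \<in> carrier (BO b)"
  then have fg: "f \<in> dilated_Omega b \<Phi> \<Delta> \<theta>" "g \<in> dilated_Omega b \<Phi> \<Delta> \<theta>" by (simp_all add: carrier_BO)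
  have "f \<otimes>\<^bsub>BO b\<^esub> g = f \<circ> g"
    using mult_BijGroup_UNIV[of f g] fg dilated_Omega_bij by (simp add: dilated_Omega_group_def)
  moreover have "lattice_action \<Phi> f \<otimes>\<^bsub>BijGroup L\<^esub> lattice_action \<Phi> g =
      compose L (lattice_action \<Phi> f) (lattice_action \<Phi> g)"
    using lattice_action_Bij fg by (simp add: BijGroup_def)
  moreover have "\<dots> = lattice_action \<Phi> (f \<circ> g)"
    using dilated_Omega_L[OF fg(2)] by (auto simp: fun_eq_iff compose_def lattice_action_def)
  ultimately show "lattice_action \<Phi> (f \<otimes>\<^bsub>BO b\<^esub> g) =
      lattice_action \<Phi> f \<otimes>\<^bsub>BijGroup L\<^esub> lattice_action \<Phi> g" by simp
qed (simp add: carrier_BO BijGroup_def lattice_action_Bij)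

text \<open>Modulo Q the displacement is b \<mu>. Cancelling \<open>b\<close> puts \<mu> into Q, so
  the undilated element is the identity.\<close>

lemma dilated_Omega_Q_cancel:
  assumes "coprime b (index_of_connection \<Phi>)"
    and "g \<in> dilated_Omega b \<Phi> \<Delta> \<theta>" "x \<in> L" "g x - x \<in> Q"
  shows "g = id"
proof -
  obtain \<mu> w where g: "\<mu> \<in> L" "w \<in> W" "translation \<mu> \<circ> w \<in> Om" "g = translation (real b *\<^sub>R \<mu>) \<circ> w"
    using assms(2) by (rule dilated_OmegaE)
  have "(g x - x) - (w x - x) \<in> Q" using Q_diff[OF assms(4) weyl_Q[OF g(2) assms(3)]] .
  then have "real b *\<^sub>R \<mu> \<in> Q" by (simp add: g(4) translation_def)
  then have "\<mu> \<in> Q" using coprime_index_cancel assms(1) g(1) by blast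
  then have *: "translation \<mu> \<circ> w = id" using Omega_coroot_translation g(2,3) by blast
  \<comment> \<open>The identity so far concerns \<mu>, not b \<mu>; evaluating at 0 gives \<mu> =
    0, where the two elements coincide.\<close>
  then have "translation \<mu> (w 0) = 0" by (metis comp_apply id_apply)
  then have "\<mu> = 0" by (simp add: translation_def linear_0[OF weyl_linear[OF g(2)]])
  with * show ?thesis unfolding g(4) by simp
qed

lemma dilated_Omega_meets_Q:
  assumes "coprime b (index_of_connection \<Phi>)" "x \<in> L"
  obtains g where "g \<in> dilated_Omega b \<Phi> \<Delta> \<theta>" "g x \<in> Q"
proof -
  obtain u :: int where u: "\<And>x. x \<in> L \<Longrightarrow> x - real b *\<^sub>R (of_int u *\<^sub>R x) \<in> Q"
    by (rule coprime_index_multiple[OF assms(1)]) (rule that)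
  \<comment> \<open>Chosen to solve b \<mu> = - x modulo Q; \<open>Omega_coset\<close> then replaces
    it by a congruent translation part of an element of \<Omega>.\<close>
  define \<mu> where "\<mu> = - (real_of_int u *\<^sub>R x)"
  have "\<mu> \<in> L" unfolding \<mu>_def by (intro L_uminus L_int_mult assms)
  then obtain \<nu> w where \<nu>: "\<nu> \<in> L" "w \<in> W" "translation \<nu> \<circ> w \<in> Om" "\<nu> - \<mu> \<in> Q"
    by (rule Omega_coset)
  have "(w x - x) + (x + real b *\<^sub>R \<mu>) + real b *\<^sub>R (\<nu> - \<mu>) \<in> Q"
    using Q_add[OF Q_add[OF weyl_Q[OF \<nu>(2) assms(2)] u[OF assms(2)]] Q_nat_mult[OF \<nu>(4), of b]]
    by (simp add: \<mu>_def)
  then have "(translation (real b *\<^sub>R \<nu>) \<circ> w) x \<in> Q"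
    by (simp add: translation_def scaleR_right_diff_distrib)
  then show ?thesis using that dilated_OmegaI[OF \<nu>(1-3)] by blast
qed

lemma free_action_BO:
  assumes "coprime b (index_of_connection \<Phi>)"
  shows "free_action (BO b) L (lattice_action \<Phi>)"
  unfolding free_action_def
proof (intro conjI ballI group_action_BO)
  fix x assume x: "x \<in> L"
  have one: "\<one>\<^bsub>BO b\<^esub> = id" using one_BijGroup_UNIV by (simp add: dilated_Omega_group_def)
  show "stabilizer (BO b) (lattice_action \<Phi>) x = {\<one>\<^bsub>BO b\<^esub>}"
    using dilated_Omega_Q_cancel[OF assms _ x] dilated_Omega_id[of b] x Q_zero
    by (auto simp: stabilizer_def carrier_BO one lattice_action_apply)
qed

lemma orbit_BO_meets_Q_once:
  assumes "coprime b (index_of_connection \<Phi>)" "X \<in> orbits (BO b) L (lattice_action \<Phi>)"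
  shows "\<exists>!q. q \<in> X \<inter> Q"
proof -
  obtain x where x: "x \<in> L" "X = {g x | g. g \<in> dilated_Omega b \<Phi> \<Delta> \<theta>}"
    using assms(2) by (auto simp: orbits_def orbit_def carrier_BO lattice_action_apply)
  obtain g where g: "g \<in> dilated_Omega b \<Phi> \<Delta> \<theta>" "g x \<in> Q"
    using assms(1) x(1) by (rule dilated_Omega_meets_Q)
  show ?thesis
  proof (rule ex1I[of _ "g x"])
    show "g x \<in> X \<inter> Q" using g x(2) by blast
    fix q assume "q \<in> X \<inter> Q"
    then obtain f where f: "f \<in> dilated_Omega b \<Phi> \<Delta> \<theta>" "q = f x" "q \<in> Q" using x(2) by blast
    \<comment> \<open>This element carries one point of Q to another, so its displacement lies in Q
      and it must be the identity.\<close>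
    have "f \<circ> inv_into UNIV g \<in> dilated_Omega b \<Phi> \<Delta> \<theta>"
      by (rule dilated_Omega_comp[OF f(1) dilated_Omega_inverse[OF g(1)]])
    moreover have *: "(f \<circ> inv_into UNIV g) (g x) = q"
      using dilated_Omega_bij[OF g(1)] by (simp add: f(2) bij_is_inj)
    moreover have "(f \<circ> inv_into UNIV g) (g x) - g x \<in> Q" unfolding * by (rule Q_diff[OF f(3) g(2)])
    ultimately have "f \<circ> inv_into UNIV g = id"
      using dilated_Omega_Q_cancel[OF assms(1)] dilated_Omega_L[OF g(1) x(1)] by blast
    with * show "q = g x" by simp
  qed
qed

end

theorem theorem2p5:
  fixes \<Phi> \<Delta> :: "'a::euclidean_space set" and \<theta> :: 'a and b :: nat
  assumes "root_system \<Phi>" and "irreducible_roots \<Phi>"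
    and "simple_roots \<Phi> \<Delta>"
    and "highest_root \<Phi> \<Delta> \<theta>" and "(norm \<theta>)\<^sup>2 = 2"
    and "b > 0" and "coprime b (index_of_connection \<Phi>)"
  shows "free_action (dilated_Omega_group b \<Phi> \<Delta> \<theta>) (coweight_lattice \<Phi>) (lattice_action \<Phi>) \<and>
    (\<forall>X \<in> orbits (dilated_Omega_group b \<Phi> \<Delta> \<theta>) (coweight_lattice \<Phi>) (lattice_action \<Phi>).
       \<exists>!q. q \<in> X \<inter> coroot_lattice \<Phi>)"
proof -
  interpret based_root_system \<Phi> \<Delta> \<theta> using assms by unfold_locales
  show ?thesis
    using free_action_BO orbit_BO_meets_Q_once \<open>coprime b (index_of_connection \<Phi>)\<close> by blast
qed

end
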